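(* Let $n\ge 2$ and $k\ge 1$ be integers, and let $R_{n,k,(n-1)}=\mathbb{C}[x_1,\ldots,x_n]/I_{n,k,(n-1)}$. Consider the set of polynomials $$\mathcal{B}_{n,k,(n-1)}=\{F_T^S\cdot e_1^i\},$$ consisting of all products where $F_T^S$ is a semistandard higher Specht polynomial with $S$ a semistandard tableau of content $(n-1,1)$ and $T$ a standard Young tableau of the same shape as $S$, and $i$ is a nonnegative integer with $i<k-\mathrm{des}(S)$. Then $\mathcal{B}_{n,k,(n-1)}$ descends to a higher Specht basis of $R_{n,k,(n-1)}$.
   Context: $S_n$ acts on polynomials by $\omega\cdot x_i=x_{\omega(i)}$; $e_1=x_1+\cdots+x_n$. For a set $X$ of variables, $e_r(X)$ is the elementary symmetric polynomial of degree $r$ in $X$. For a partition $\mu$ with conjugate $\mu'$ ($\mu'_j=0$ for $j>\mu_1$), $c_t(\mu)=\mu'_1+\cdots+\mu'_t-t$. Griffin's ideal $I_{n,k,\mu}$ is generated by $x_1^k,\ldots,x_n^k$ together with all $e_r(X)$, $X\subseteq\{x_1,\ldots,x_n\}$, with $c_{n-|X|}(\mu)+(n-|\mu|)<r\le |X|$; here $\mu=(n-1)$. Tableaux are in French convention. A semistandard tableau $S$ of content $(n-1,1)$ has entries $n-1$ ones and a single $2$; it has either one row (shape $(n)$) or shape $(n-1,1)$ with the $2$ in the top row. $\mathrm{des}(S)$ is the number of values $i$ such that some $i+1$ lies in a strictly higher row than an $i$; thus $\mathrm{des}(S)=0$ if $S$ has one row and $\mathrm{des}(S)=1$ if $S$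 has shape $(n-1,1)$. Cocharge labels: in the reading word of $S$ (rows read top to bottom, each left to right), decompose into standard subwords (repeatedly: take the rightmost remaining $1$, then the remaining $2$ cyclically to its left, i.e. the rightmost remaining $2$ to its left if one exists, otherwise the rightmost remaining $2$); within a standard subword the $1$ gets label $0$ and the $2$ gets label $0$ if it is right of the $1$, else $1$. $\mathrm{cw}_S(s)$ is the label of box $s$. Then $\mathbf{x}_T^S=\prod_s x_{T(s)}^{\mathrm{cw}_S(s)}$, and $F_T^S=\varepsilon_T\cdot\mathbf{x}_T^S$ with $\varepsilon_T=\sum_{\tau\in C(T)}\sum_{\sigma\in R(T)}\mathrm{sgn}(\tau)\tau\sigma$, $C(T)$, $R(T)$ the column- and row-stabilizers of $T$ in $S_n$. A set of polynomials descends to a higher Specht basis of $R$ if its images form a basis of $R$ and can be partitioned into subsets each of which is a basis of an $S_n$-submodule isomorphic to an irreducible $V_\lambda$, these submodules forming a direct sum decomposition of $R$. *)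

theory Defs
  imports
    "HOL-Library.Poly_Mapping"
    "HOL-Library.Disjoint_Sets"
    "HOL-Combinatorics.Permutations"
    "HOL-Algebra.QuotRing"
    "HOL-Algebra.Sym_Groups"
    "Jordan_Normal_Form.VS_Connect"
    Complex_Main
begin

section \<open>The polynomial ring and the action of the symmetric group\<close>

type_synonym mpoly = "(nat \<Rightarrow>\<^sub>0 nat) \<Rightarrow>\<^sub>0 complex"

definition Var :: "nat \<Rightarrow> mpoly" where
  "Var i = Poly_Mapping.single (Poly_Mapping.single i 1) 1"

definition Const :: "complex \<Rightarrow> mpoly" where
  "Const c = Poly_Mapping.single 0 c"

text \<open>The complex algebra of polynomials in \<open>x\<^sub>1, \<dots>, x\<^sub>n\<close>.\<close>

definition poly_alg :: "nat \<Rightarrow> (complex, mpoly) module" where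
  "poly_alg n =
     \<lparr>carrier = {f. \<forall>m\<in>Poly_Mapping.keys f. Poly_Mapping.keys m \<subseteq> {1..n}},
      monoid.mult = (*), one = 1, zero = 0, add = (+), smult = (\<lambda>c f. Const c * f)\<rparr>"

text \<open>
  The coefficient of \<open>x\<^sup>m\<close> in \<open>\<sigma> \<cdot> f\<close> is that of \<open>x\<close> to the power \<open>m \<circ> \<sigma>\<close> in \<open>f\<close>, so that
  \<open>\<sigma> \<cdot> x\<^sub>i\<close> is the variable with index \<open>\<sigma> i\<close>. Only meaningful for bijective \<open>\<sigma>\<close>.
\<close>

definition perm_poly :: "(nat \<Rightarrow> nat) \<Rightarrow> mpoly \<Rightarrow> mpoly" where
  "perm_poly \<sigma> f = Poly_Mapping.map_key (Poly_Mapping.map_key \<sigma>) f"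

lemma inj_map_key:
  fixes \<sigma> :: "nat \<Rightarrow> nat"
  assumes "bij \<sigma>"
  shows "inj (Poly_Mapping.map_key \<sigma> :: (nat \<Rightarrow>\<^sub>0 nat) \<Rightarrow> (nat \<Rightarrow>\<^sub>0 nat))"
proof (rule injI)
  fix m m' :: "nat \<Rightarrow>\<^sub>0 nat"
  assume eq: "Poly_Mapping.map_key \<sigma> m = Poly_Mapping.map_key \<sigma> m'"
  have inj: "inj \<sigma>" using assms by (rule bij_is_inj)
  have "Poly_Mapping.lookup m (\<sigma> i) = Poly_Mapping.lookup m' (\<sigma> i)" for i
    using arg_cong[OF eq, of "\<lambda>p. Poly_Mapping.lookup p i"] inj by (simp add: map_key.rep_eq)
  then show "m = m'"
    using assms by (metis bij_pointE poly_mapping_eqI)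
qed

lemma perm_poly_Var:
  assumes "bij \<sigma>"
  shows "perm_poly \<sigma> (Var i) = Var (\<sigma> i)"
proof -
  have inj: "inj \<sigma>" using assms by (rule bij_is_inj)
  have "Poly_Mapping.map_key \<sigma> (Poly_Mapping.single (\<sigma> i) (1::nat)) = Poly_Mapping.single i 1"
    by (rule map_key_single[OF inj])
  then show ?thesis
    unfolding perm_poly_def Var_def
    using map_key_single[OF inj_map_key[OF assms], of "Poly_Mapping.single (\<sigma> i) 1" "1::complex"]
    by simp
qed

definition elem_sym :: "nat \<Rightarrow> nat set \<Rightarrow> mpoly" where
  "elem_sym r X = (\<Sum>A | A \<subseteq> X \<and> card A = r. \<Prod>i\<in>A. Var i)"


section \<open>Partitions and Griffin's ideals\<close>

definition is_partition :: "nat list \<Rightarrow> bool" where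
  "is_partition \<nu> \<longleftrightarrow> sorted_wrt (\<ge>) \<nu> \<and> 0 \<notin> set \<nu>"

text \<open>\<open>conj_part \<mu> j\<close> is \<open>\<mu>'\<^sub>j\<close>, with indices starting at 1.\<close>

definition conj_part :: "nat list \<Rightarrow> nat \<Rightarrow> nat" where
  "conj_part \<mu> j = card {i. i < length \<mu> \<and> j \<le> \<mu> ! i}"

definition c_bound :: "nat list \<Rightarrow> nat \<Rightarrow> int" where
  "c_bound \<mu> t = (\<Sum>j=1..t. int (conj_part \<mu> j)) - int t"

definition griffin_ideal :: "nat \<Rightarrow> nat \<Rightarrow> nat list \<Rightarrow> mpoly set" where
  "griffin_ideal n k \<mu> = genideal (poly_alg n)
     ({Var i ^ k | i. i \<in> {1..n}} \<union>
      {elem_sym r X | r X. X \<subseteq> {1..n} \<and> r \<le> card X \<and>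
         c_bound \<mu> (n - card X) + (int n - int (sum_list \<mu>)) < int r})"

text \<open>The quotient algebra, with scalars acting through the classes of constant polynomials.\<close>

definition quot_alg :: "nat \<Rightarrow> mpoly set \<Rightarrow> (complex, mpoly set) module" where
  "quot_alg n I = (let Q = poly_alg n Quot I in
     \<lparr>carrier = carrier Q, monoid.mult = monoid.mult Q, one = one Q, zero = zero Q, add = add Q,
      smult = (\<lambda>c X. (I +>\<^bsub>poly_alg n\<^esub> Const c) \<otimes>\<^bsub>Q\<^esub> X)\<rparr>)"

definition perm_coset :: "(nat \<Rightarrow> nat) \<Rightarrow> mpoly set \<Rightarrow> mpoly set" where
  "perm_coset \<sigma> X = perm_poly \<sigma> ` X"


section \<open>Tableaux\<close>

text \<open>
  A tableau is the list of its rows in French convention: row \<open>0\<close> is the bottom (longest) row,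
  and larger row indices are higher up.
\<close>

type_synonym tableau = "nat list list"

definition shape :: "tableau \<Rightarrow> nat list" where
  "shape T = map length T"

definition cells :: "tableau \<Rightarrow> (nat \<times> nat) set" where
  "cells T = {(r, c). r < length T \<and> c < length (T ! r)}"

definition entry :: "tableau \<Rightarrow> nat \<times> nat \<Rightarrow> nat" where
  "entry T s = T ! fst s ! snd s"

definition semistandard :: "tableau \<Rightarrow> bool" where
  "semistandard S \<longleftrightarrow> is_partition (shape S) \<and> (\<forall>row\<in>set S. sorted row) \<and>
     (\<forall>r c. (Suc r, c) \<in> cells S \<longrightarrow> entry S (r, c) < entry S (Suc r, c))"

definition has_content :: "tableau \<Rightarrow> nat list \<Rightarrow> bool" where
  "has_content S \<alpha> \<longleftrightarrow>
     (\<forall>i. count_list (concat S) i = (if 1 \<le> i \<and> i \<le> length \<alpha> then \<alpha> ! (i - 1) else 0))"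

definition bij_filling :: "nat \<Rightarrow> tableau \<Rightarrow> bool" where
  "bij_filling n T \<longleftrightarrow> distinct (concat T) \<and> set (concat T) = {1..n}"

definition standard :: "nat \<Rightarrow> tableau \<Rightarrow> bool" where
  "standard n T \<longleftrightarrow> semistandard T \<and> bij_filling n T"

definition des :: "tableau \<Rightarrow> nat" where
  "des S = card {i. \<exists>s\<in>cells S. \<exists>s'\<in>cells S.
     entry S s = i \<and> entry S s' = Suc i \<and> fst s < fst s'}"


section \<open>Cocharge labels\<close>

definition reading_word :: "tableau \<Rightarrow> nat list" where
  "reading_word S = concat (rev S)"

definition reading_pos :: "tableau \<Rightarrow> nat \<times> nat \<Rightarrow> nat" where
  "reading_pos S s = length (concat (rev (drop (Suc (fst s)) S))) + snd s"

text \<open>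
  \<open>next_pos w P a p\<close> is the first position in \<open>P\<close> carrying the letter \<open>a\<close> that is met when
  moving cyclically to the left from position \<open>p\<close> in the word \<open>w\<close>.
\<close>

definition next_pos :: "nat list \<Rightarrow> nat set \<Rightarrow> nat \<Rightarrow> nat \<Rightarrow> nat option" where
  "next_pos w P a p =
     (let Q = {q \<in> P. w ! q = a}; L = {q \<in> Q. q < p} in
      if L \<noteq> {} then Some (Max L) else if Q \<noteq> {} then Some (Max Q) else None)"

text \<open>
  Position of the letter \<open>a\<close> in the standard subword extracted from the positions \<open>P\<close> of \<open>w\<close>.
  Starting past the end of \<open>w\<close> makes the letter 1 the rightmost one.
\<close>

primrec sub_pos :: "nat list \<Rightarrow> nat set \<Rightarrow> nat \<Rightarrow> nat option" where
  "sub_pos w P 0 = Some (length w)"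
| "sub_pos w P (Suc a) =
     (case sub_pos w P a of None \<Rightarrow> None | Some p \<Rightarrow> next_pos w P (Suc a) p)"

text \<open>Positions left after \<open>j\<close> standard subwords have been removed.\<close>

primrec remaining :: "nat list \<Rightarrow> nat \<Rightarrow> nat set" where
  "remaining w 0 = {..<length w}"
| "remaining w (Suc j) =
     remaining w j - {q. \<exists>a\<ge>1. sub_pos w (remaining w j) a = Some q}"

text \<open>
  Within a standard subword the letter 1 is labelled 0, and \<open>b + 1\<close> gets the label of \<open>b\<close> if it
  lies to the right of \<open>b\<close>, and one more than that otherwise. Hence the label of a letter \<open>a\<close>
  counts the \<open>b < a\<close> with \<open>b + 1\<close> to the left of \<open>b\<close>.
\<close>

definition cocharge_label :: "nat list \<Rightarrow> nat \<Rightarrow> nat" where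
  "cocharge_label w q =
     (let P = remaining w (LEAST j. q \<notin> remaining w (Suc j)) in
      card {b. 1 \<le> b \<and> b < w ! q \<and> the (sub_pos w P (Suc b)) < the (sub_pos w P b)})"

definition cw :: "tableau \<Rightarrow> nat \<times> nat \<Rightarrow> nat" where
  "cw S s = cocharge_label (reading_word S) (reading_pos S s)"


section \<open>Semistandard higher Specht polynomials\<close>

definition row_stab :: "nat \<Rightarrow> tableau \<Rightarrow> (nat \<Rightarrow> nat) set" where
  "row_stab n T = {\<sigma> \<in> carrier (sym_group n).
     \<forall>r. \<sigma> ` {entry T s | s. s \<in> cells T \<and> fst s = r} = {entry T s | s. s \<in> cells T \<and> fst s = r}}"

definition col_stab :: "nat \<Rightarrow> tableau \<Rightarrow> (nat \<Rightarrow> nat) set" where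
  "col_stab n T = {\<tau> \<in> carrier (sym_group n).
     \<forall>c. \<tau> ` {entry T s | s. s \<in> cells T \<and> snd s = c} = {entry T s | s. s \<in> cells T \<and> snd s = c}}"

definition young_sym :: "nat \<Rightarrow> tableau \<Rightarrow> mpoly \<Rightarrow> mpoly" where
  "young_sym n T f =
     (\<Sum>\<tau>\<in>col_stab n T. \<Sum>\<sigma>\<in>row_stab n T. of_int (sign \<tau>) * perm_poly (\<tau> \<circ> \<sigma>) f)"

definition cw_monomial :: "tableau \<Rightarrow> tableau \<Rightarrow> mpoly" where
  "cw_monomial S T = (\<Prod>s\<in>cells S. Var (entry T s) ^ cw S s)"

definition higher_specht :: "nat \<Rightarrow> tableau \<Rightarrow> tableau \<Rightarrow> mpoly" where
  "higher_specht n S T = young_sym n T (cw_monomial S T)"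

text \<open>The set \<open>\<B>\<close> for \<open>\<mu> = (n - 1)\<close>.\<close>

definition B_set :: "nat \<Rightarrow> nat \<Rightarrow> mpoly set" where
  "B_set n k = {higher_specht n S T * elem_sym 1 {1..n} ^ i | S T i.
     semistandard S \<and> has_content S [n - 1, 1] \<and>
     standard n T \<and> shape T = shape S \<and> i < k - des S}"


section \<open>Modules over the symmetric group\<close>

definition Sn_module ::
  "nat \<Rightarrow> (complex, 'v) module \<Rightarrow> ((nat \<Rightarrow> nat) \<Rightarrow> 'v \<Rightarrow> 'v) \<Rightarrow> bool" where
  "Sn_module n V \<phi> \<longleftrightarrow> vectorspace class_ring V \<and>
     (\<forall>\<sigma>\<in>carrier (sym_group n). \<phi> \<sigma> \<in> LinearCombinations.module_hom class_ring V V) \<and>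
     (\<forall>v\<in>carrier V. \<phi> id v = v) \<and>
     (\<forall>\<sigma>\<in>carrier (sym_group n). \<forall>\<tau>\<in>carrier (sym_group n). \<forall>v\<in>carrier V.
        \<phi> (\<sigma> \<circ> \<tau>) v = \<phi> \<sigma> (\<phi> \<tau> v))"

definition Sn_submodule ::
  "nat \<Rightarrow> (complex, 'v) module \<Rightarrow> ((nat \<Rightarrow> nat) \<Rightarrow> 'v \<Rightarrow> 'v) \<Rightarrow> 'v set \<Rightarrow> bool" where
  "Sn_submodule n V \<phi> W \<longleftrightarrow> Sn_module n V \<phi> \<and> VectorSpace.subspace class_ring W V \<and>
     (\<forall>\<sigma>\<in>carrier (sym_group n). \<forall>w\<in>W. \<phi> \<sigma> w \<in> W)"

definition Sn_irreducible ::
  "nat \<Rightarrow> (complex, 'v) module \<Rightarrow> ((nat \<Rightarrow> nat) \<Rightarrow> 'v \<Rightarrow> 'v) \<Rightarrow> bool" where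
  "Sn_irreducible n V \<phi> \<longleftrightarrow> Sn_module n V \<phi> \<and> carrier V \<noteq> {\<zero>\<^bsub>V\<^esub>} \<and>
     (\<forall>W. Sn_submodule n V \<phi> W \<longrightarrow> W = {\<zero>\<^bsub>V\<^esub>} \<or> W = carrier V)"

definition Sn_isomorphic ::
  "nat \<Rightarrow> (complex, 'v) module \<Rightarrow> ((nat \<Rightarrow> nat) \<Rightarrow> 'v \<Rightarrow> 'v) \<Rightarrow>
   (complex, 'w) module \<Rightarrow> ((nat \<Rightarrow> nat) \<Rightarrow> 'w \<Rightarrow> 'w) \<Rightarrow> bool" where
  "Sn_isomorphic n V \<phi> W \<psi> \<longleftrightarrow> Sn_module n V \<phi> \<and> Sn_module n W \<psi> \<and>
     (\<exists>f\<in>LinearCombinations.module_hom class_ring V W. bij_betw f (carrier V) (carrier W) \<and>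
        (\<forall>\<sigma>\<in>carrier (sym_group n). \<forall>v\<in>carrier V. f (\<phi> \<sigma> v) = \<psi> \<sigma> (f v)))"

text \<open>
  The module \<open>V\<^sub>\<nu>\<close>, in Specht's original realization: the span of the products of the
  Vandermonde determinants of the columns of all bijective fillings of \<open>\<nu>\<close>.
  In particular one-row shapes give the trivial and one-column shapes the sign representation.
\<close>

definition specht_poly :: "tableau \<Rightarrow> mpoly" where
  "specht_poly T = (\<Prod>(r, r', c) | r < r' \<and> (r', c) \<in> cells T.
     Var (entry T (r', c)) - Var (entry T (r, c)))"

definition specht_module :: "nat \<Rightarrow> nat list \<Rightarrow> (complex, mpoly) module" where
  "specht_module n \<nu> = (poly_alg n)\<lparr>carrier :=
     LinearCombinations.module.span class_ring (poly_alg n)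
       {specht_poly T | T. shape T = \<nu> \<and> bij_filling n T}\<rparr>"

text \<open>Internal direct sum of a family of subspaces.\<close>

definition is_direct_sum :: "(complex, 'v) module \<Rightarrow> 'i set \<Rightarrow> ('i \<Rightarrow> 'v set) \<Rightarrow> bool" where
  "is_direct_sum V I W \<longleftrightarrow>
     LinearCombinations.module.span class_ring V (\<Union>i\<in>I. W i) = carrier V \<and>
     (\<forall>i\<in>I. W i \<inter> LinearCombinations.module.span class_ring V (\<Union>j\<in>I - {i}. W j) = {\<zero>\<^bsub>V\<^esub>})"

definition higher_specht_basis ::
  "nat \<Rightarrow> (complex, 'v) module \<Rightarrow> ((nat \<Rightarrow> nat) \<Rightarrow> 'v \<Rightarrow> 'v) \<Rightarrow> 'v set \<Rightarrow> bool" where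
  "higher_specht_basis n V \<phi> A \<longleftrightarrow> Sn_module n V \<phi> \<and> vectorspace.basis class_ring V A \<and>
     (\<exists>\<P> W. partition_on A \<P> \<and>
        (\<forall>\<beta>\<in>\<P>. Sn_submodule n V \<phi> (W \<beta>) \<and>
           vectorspace.basis class_ring (V\<lparr>carrier := W \<beta>\<rparr>) \<beta> \<and>
           Sn_irreducible n (V\<lparr>carrier := W \<beta>\<rparr>) \<phi> \<and>
           (\<exists>\<nu>. is_partition \<nu> \<and> sum_list \<nu> = n \<and>
              Sn_isomorphic n (V\<lparr>carrier := W \<beta>\<rparr>) \<phi> (specht_module n \<nu>) perm_poly)) \<and>
        is_direct_sum V \<P> W)"

text \<open>
  That the images of \<open>B\<close> form a basis is meant for the family indexed by \<open>B\<close>, hence injectivity.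
\<close>

definition descends_to_higher_specht_basis :: "nat \<Rightarrow> mpoly set \<Rightarrow> mpoly set \<Rightarrow> bool" where
  "descends_to_higher_specht_basis n I B \<longleftrightarrow> B \<subseteq> carrier (poly_alg n) \<and>
     inj_on (\<lambda>f. I +>\<^bsub>poly_alg n\<^esub> f) B \<and>
     higher_specht_basis n (quot_alg n I) perm_coset ((\<lambda>f. I +>\<^bsub>poly_alg n\<^esub> f) ` B)"

end

theory Submission
  imports Defs
begin

text \<open>
  Griffin's ideal for \<open>\<mu> = (n - 1)\<close> is generated by the \<open>x\<^sub>i\<^sup>k\<close> and the products \<open>x\<^sub>i x\<^sub>j\<close>
  with \<open>i \<noteq> j\<close>, so a polynomial lies in it iff its coefficients at the monomials \<open>x\<^sub>j\<^sup>d\<close> with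
  \<open>d < k\<close> vanish, and these coefficients are coordinates on the quotient. The higher Specht
  polynomials are \<open>n!\<close> and \<open>(n - 1)! (x\<^sub>b - x\<^sub>1)\<close>; modulo the ideal, multiplying them by powers of
  \<open>e\<^sub>1\<close> gives \<open>n! (x\<^sub>1\<^sup>d + \<dots> + x\<^sub>n\<^sup>d)\<close> and \<open>(n - 1)! (x\<^sub>b\<^sup>d - x\<^sub>1\<^sup>d)\<close>. For fixed \<open>d > 0\<close> the classes of
  \<open>x\<^sub>1\<^sup>d, \<dots>, x\<^sub>n\<^sup>d\<close> span a copy of the permutation representation, which splits into the line of
  the power sum and the irreducible space of combinations with coefficient sum zero. The
  functionals dual to the claimed basis are the mean of the coefficients in degree \<open>d\<close> and the
  deviations from it, up to scaling.
\<close>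

text \<open>For \<open>\<mu> = (n - 1)\<close> the bound in Griffin's definition is 1 as soon as
  \<open>X\<close> is nonempty, so what counts among the elementary symmetric generators is
  \<open>e_2\<close> of two variables, a product of two distinct variables. The range
  \<open>i < k - des S\<close> says that the total degree \<open>i + des S\<close> of a product
  stays below \<open>k\<close>, because \<open>F_T^S\<close> is homogeneous of degree
  \<open>des S\<close>. Degree 0 is exceptional throughout: all \<open>x_j^0\<close> are the same
  monomial, so this degree contributes only the invariant line. Functionals that are dual and
  jointly separate points give at once the basis of the quotient, the bases of its summands and the
  directness of the sum. The isomorphism types come from treating the line and the sum-zero
  combinations abstractly and instantiating them twice: in the quotient, and in the polynomial ring,
  where degrees 0 and 1 yield the Specht modules of shapes \<open>(n)\<close> and
  \<open>(n - 1, 1)\<close>.\<close>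

section \<open>Double transitivity and linear functionals\<close>

lemma permutes_pair_exists:
  assumes "i \<in> A" "j \<in> A" "i \<noteq> j" "b \<in> A" "c \<in> A" "b \<noteq> c"
  shows "\<exists>\<sigma>. \<sigma> permutes A \<and> \<sigma> i = b \<and> \<sigma> j = c"
proof (intro exI conjI)
  \<comment> \<open>The first transposition sends \<open>i\<close> to \<open>b\<close> and
    \<open>j\<close> to an element other than \<open>b\<close>; the second carries that element to
    \<open>c\<close> and leaves \<open>b\<close> alone, since \<open>b \<noteq> c\<close>.\<close>
  let ?s = "transpose (transpose i b j) c \<circ> transpose i b"
  show "?s permutes A"
    using assms by (intro permutes_compose permutes_swap_id) (auto simp: transpose_def)
  show "?s i = b" "?s j = c"
    using assms by (auto simp: transpose_def)
qed

definition functional :: "('a::field, 'v) module \<Rightarrow> ('v \<Rightarrow> 'a) \<Rightarrow> bool" where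
  "functional V f \<longleftrightarrow>
     (\<forall>x\<in>carrier V. \<forall>y\<in>carrier V. f (x \<oplus>\<^bsub>V\<^esub> y) = f x + f y) \<and>
     (\<forall>c. \<forall>x\<in>carrier V. f (c \<odot>\<^bsub>V\<^esub> x) = c * f x)"

lemma vectorspace_smult_simps:
  assumes "vectorspace class_ring V" "x \<in> carrier V"
  shows "1 \<odot>\<^bsub>V\<^esub> x = x" "0 \<odot>\<^bsub>V\<^esub> x = \<zero>\<^bsub>V\<^esub>"
proof -
  interpret vectorspace class_ring V by fact
  show "1 \<odot>\<^bsub>V\<^esub> x = x" "0 \<odot>\<^bsub>V\<^esub> x = \<zero>\<^bsub>V\<^esub>"
    using smult_one[OF assms(2)] smult_l_null[OF assms(2)] by simp_all
qed

lemma functional_restrict: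
  "functional V f \<Longrightarrow> W \<subseteq> carrier V \<Longrightarrow> functional (V\<lparr>carrier := W\<rparr>) f"
  unfolding functional_def by (auto simp: subset_iff)

lemma functional_zero:
  assumes "vectorspace class_ring V" "functional V f"
  shows "f \<zero>\<^bsub>V\<^esub> = 0"
proof -
  interpret vectorspace class_ring V by fact
  have "f (0 \<odot>\<^bsub>V\<^esub> \<zero>\<^bsub>V\<^esub>) = 0 * f \<zero>\<^bsub>V\<^esub>"
    using assms(2) unfolding functional_def by blast
  then show ?thesis by (simp add: smult_r_null)
qed

lemma functional_finsum:
  assumes "vectorspace class_ring V" "functional V f" "finite A" "g \<in> A \<rightarrow> carrier V"
  shows "f (finsum V g A) = (\<Sum>a\<in>A. f (g a))"
proof -
  interpret vectorspace class_ring V by fact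
  show ?thesis using assms(3,4)
  proof (induction A)
    case empty
    then show ?case by (simp add: functional_zero[OF assms(1,2)])
  next
    case (insert a A)
    then show ?case using assms(2) unfolding functional_def by simp
  qed
qed

lemma submodule_finsum:
  assumes "submodule class_ring W V" "finite A" "g \<in> A \<rightarrow> W"
  shows "finsum V g A \<in> W"
proof -
  interpret submodule class_ring W V by fact
  interpret Module.module class_ring V by (rule module)
  show ?thesis using assms(2,3)
  proof (induction A)
    case (insert a A)
    then have "g \<in> insert a A \<rightarrow> carrier V" using subset by auto
    with insert show ?case by simp
  qed simp
qed

lemma (in vectorspace) cancel_zero_diff:
  assumes "x \<in> carrier V" "y \<in> carrier V" "x \<ominus>\<^bsub>V\<^esub> y = \<zero>\<^bsub>V\<^esub>"
  shows "x = y"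
  proof -
  have "x = (x \<ominus>\<^bsub>V\<^esub> y) \<oplus>\<^bsub>V\<^esub> y"
    using assms(1,2) by (simp add: M.minus_eq M.a_assoc M.l_neg)
  then show ?thesis using assms by simp
qed

lemma functional_diff:
  assumes "vectorspace class_ring V" "functional V f" "x \<in> carrier V" "y \<in> carrier V"
  shows "f (x \<ominus>\<^bsub>V\<^esub> y) = f x - f y"
proof -
  interpret vectorspace class_ring V by fact
  have "f ((x \<ominus>\<^bsub>V\<^esub> y) \<oplus>\<^bsub>V\<^esub> y) = f (x \<ominus>\<^bsub>V\<^esub> y) + f y"
    using assms unfolding functional_def by simp
  moreover have "(x \<ominus>\<^bsub>V\<^esub> y) \<oplus>\<^bsub>V\<^esub> y = x"
    using assms by (simp add: M.minus_eq M.a_assoc M.l_neg)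
  ultimately show ?thesis by simp
qed

section \<open>Families with dual functionals\<close>

text \<open>\<open>sep\<close> stands in for spanning: by duality every functional kills the
  difference of a vector and its expansion, and separation turns this into equality.\<close>

locale dual_basis =
  fixes V :: "('a::field, 'v) module" and J :: "'i set" and v :: "'i \<Rightarrow> 'v"
    and \<phi> :: "'i \<Rightarrow> 'v \<Rightarrow> 'a"
  assumes vs: "vectorspace class_ring V"
    and finJ: "finite J"
    and closed: "j \<in> J \<Longrightarrow> v j \<in> carrier V"
    and func: "j \<in> J \<Longrightarrow> functional V (\<phi> j)"
    and dual: "i \<in> J \<Longrightarrow> j \<in> J \<Longrightarrow> \<phi> i (v j) = (if i = j then 1 else 0)"
    and sep: "x \<in> carrier V \<Longrightarrow> (\<And>j. j \<in> J \<Longrightarrow> \<phi> j x = 0) \<Longrightarrow> x = \<zero>\<^bsub>V\<^esub>"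
begin

sublocale vectorspace class_ring V by (rule vs)

lemma inj: "inj_on v J"
  by (rule inj_onI) (metis dual zero_neq_one)

lemma vanishing_submodule:
  assumes "K \<subseteq> J"
  shows "submodule class_ring {x \<in> carrier V. \<forall>i\<in>K. \<phi> i x = 0} V"
proof
  have f: "functional V (\<phi> i)" if "i \<in> K" for i using func assms that by auto
  show "\<zero>\<^bsub>V\<^esub> \<in> {x \<in> carrier V. \<forall>i\<in>K. \<phi> i x = 0}"
    using functional_zero[OF vs f] by simp
qed (use func assms in \<open>auto simp: functional_def subset_iff\<close>)

text \<open>Subtracting from \<open>x\<close> its expansion over \<open>K\<close> leaves a vector on
  which all functionals vanish. With spans written as joint kernels, intersections of spans become
  statements about vanishing coordinates.\<close>

lemma span_eq:
  assumes "K \<subseteq> J"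
  shows "span (v ` K) = {x \<in> carrier V. \<forall>i\<in>J - K. \<phi> i x = 0}"
proof
  have "v ` K \<subseteq> {x \<in> carrier V. \<forall>i\<in>J - K. \<phi> i x = 0}"
    using assms by (auto simp: closed dual subset_iff)
  then show "span (v ` K) \<subseteq> {x \<in> carrier V. \<forall>i\<in>J - K. \<phi> i x = 0}"
    by (rule span_is_subset) (rule vanishing_submodule, auto)
next
  have vK: "v ` K \<subseteq> carrier V" using assms closed by auto
  have finK: "finite K" using assms finJ finite_subset by auto
  interpret S: submodule class_ring "span (v ` K)" V
    by (rule span_is_submodule[OF vK])
  show "{x \<in> carrier V. \<forall>i\<in>J - K. \<phi> i x = 0} \<subseteq> span (v ` K)"
  proof
    fix x assume "x \<in> {x \<in> carrier V. \<forall>i\<in>J - K. \<phi> i x = 0}"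
    then have x: "x \<in> carrier V" "\<And>i. i \<in> J - K \<Longrightarrow> \<phi> i x = 0" by auto
    let ?g = "\<lambda>j. \<phi> j x \<odot>\<^bsub>V\<^esub> v j"
    let ?y = "finsum V ?g K"
    have g: "?g \<in> K \<rightarrow> span (v ` K)"
      using in_own_span[OF vK] by (auto intro!: S.smult_closed)
    then have y: "?y \<in> span (v ` K)"
      by (intro submodule_finsum S.submodule_axioms finK)
    then have yV: "?y \<in> carrier V" using S.subset by auto
    have gV: "?g \<in> K \<rightarrow> carrier V" using g S.subset by auto
    have "\<phi> i ?y = \<phi> i x" if i: "i \<in> J" for i
    proof -
      have "\<phi> i ?y = (\<Sum>j\<in>K. \<phi> i (?g j))"
        by (rule functional_finsum[OF vs func[OF i] finK gV])
      also have "\<dots> = (\<Sum>j\<in>K. if i = j then \<phi> j x else 0)"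
        using i assms func[OF i] by (intro sum.cong) (auto simp: functional_def closed dual subset_iff)
      \<comment> \<open>For \<open>i\<close> outside \<open>K\<close> no term survives, and
        \<open>x(2)\<close> supplies the value 0.\<close>
      also have "\<dots> = \<phi> i x" using finK x(2) i by auto
      finally show ?thesis .
    qed
    then have "x \<ominus>\<^bsub>V\<^esub> ?y = \<zero>\<^bsub>V\<^esub>"
      using x(1) yV by (intro sep) (auto simp: functional_diff[OF vs func])
    then have "x = ?y" by (rule cancel_zero_diff[OF x(1) yV])
    then show "x \<in> span (v ` K)" using y by simp
  qed
qed

lemma indep: "lin_indpt (v ` J)"
proof (rule finite_lin_indpt2)
  show "finite (v ` J)" using finJ by simp
  show "v ` J \<subseteq> carrier V" using closed by auto
  fix a assume a: "lincomb a (v ` J) = \<zero>\<^bsub>V\<^esub>"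
  have "a (v i) = 0" if i: "i \<in> J" for i
  proof -
    have "0 = \<phi> i (lincomb a (v ` J))"
      using a functional_zero[OF vs func[OF i]] by simp
    also have "\<dots> = (\<Sum>w\<in>v ` J. \<phi> i (a w \<odot>\<^bsub>V\<^esub> w))"
      unfolding lincomb_def
      by (rule functional_finsum[OF vs func[OF i]]) (auto simp: finJ closed)
    also have "\<dots> = (\<Sum>j\<in>J. \<phi> i (a (v j) \<odot>\<^bsub>V\<^esub> v j))"
      by (simp add: sum.reindex[OF inj])
    also have "\<dots> = (\<Sum>j\<in>J. if i = j then a (v j) else 0)"
      using i func[OF i] by (intro sum.cong) (auto simp: functional_def closed dual)
    also have "\<dots> = a (v i)" using finJ i by simp
    finally show ?thesis by simp
  qed
  then show "\<forall>w\<in>v ` J. a w = \<zero>\<^bsub>class_ring\<^esub>" by auto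
qed

lemma is_basis: "basis (v ` J)"
proof -
  have "span (v ` J) = carrier V" using span_eq[of J] by auto
  then show ?thesis unfolding basis_def using indep closed by auto
qed

text \<open>The functionals indexed by \<open>K\<close> remain dual on the span and still separate
  its points, because those outside \<open>K\<close> vanish there by \<open>span_eq\<close>.\<close>

lemma basis_span:
  assumes "K \<subseteq> J"
  shows "vectorspace.basis class_ring (V\<lparr>carrier := span (v ` K)\<rparr>) (v ` K)"
proof -
  have vK: "v ` K \<subseteq> carrier V" using assms closed by auto
  interpret S: submodule class_ring "span (v ` K)" V
    by (rule span_is_submodule[OF vK])
  interpret sub: dual_basis "V\<lparr>carrier := span (v ` K)\<rparr>" K v \<phi>
  proof (rule dual_basis.intro)
    show "finite K" using assms finJ finite_subset by auto
    show "vectorspace class_ring (V\<lparr>carrier := span (v ` K)\<rparr>)"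
      by (rule subspace_is_vs[OF span_is_subspace[OF vK]])
    show "v j \<in> carrier (V\<lparr>carrier := span (v ` K)\<rparr>)" if "j \<in> K" for j
      using that in_own_span[OF vK] by auto
    show "functional (V\<lparr>carrier := span (v ` K)\<rparr>) (\<phi> j)" if "j \<in> K" for j
      using that assms func S.subset by (intro functional_restrict) auto
    show "\<phi> i (v j) = (if i = j then 1 else 0)" if "i \<in> K" "j \<in> K" for i j
      by (rule dual) (use that assms in auto)
    show "x = \<zero>\<^bsub>V\<lparr>carrier := span (v ` K)\<rparr>\<^esub>"
      if "x \<in> carrier (V\<lparr>carrier := span (v ` K)\<rparr>)" "\<And>j. j \<in> K \<Longrightarrow> \<phi> j x = 0" for x
    proof -
      have "x \<in> carrier V" "\<phi> j x = 0" if "j \<in> J" for j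
        using \<open>x \<in> _\<close> \<open>\<And>j. j \<in> K \<Longrightarrow> \<phi> j x = 0\<close> that by (auto simp: span_eq[OF assms])
      then show ?thesis using sep[of x] that(1) by (auto simp: span_eq[OF assms])
    qed
  qed
  show ?thesis by (rule sub.is_basis)
qed

end

text \<open>A vector in one summand has zero coordinates outside its block; a vector in the span of
  the other summands has zero coordinates inside it. A common vector is zero by separation. The
  index set consists of the images of the blocks, the form in which
  \<open>higher_specht_basis\<close> uses it.\<close>

lemma direct_sum_span:
  fixes V :: "(complex, 'v) module"
  assumes "dual_basis V J v \<phi>" "partition_on J P"
  shows "is_direct_sum V ((`) v ` P) (LinearCombinations.module.span class_ring V)"
proof -
  interpret dual_basis V J v \<phi> by fact
  have sub: "K \<subseteq> J" if "K \<in> P" for K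
    using that partition_onD1[OF assms(2)] by auto
  have vK: "v ` K \<subseteq> carrier V" if "K \<in> P" for K
    using sub[OF that] closed by auto
  have "span (\<Union>\<beta>\<in>(`) v ` P. span \<beta>) = carrier V"
  proof
    show "span (\<Union>\<beta>\<in>(`) v ` P. span \<beta>) \<subseteq> carrier V"
      using vK span_is_subset2 by (intro span_is_subset2) blast
    have "v ` J \<subseteq> (\<Union>\<beta>\<in>(`) v ` P. span \<beta>)"
      using in_own_span[OF vK] partition_onD1[OF assms(2)] by fastforce
    from span_is_monotone[OF this] show "carrier V \<subseteq> span (\<Union>\<beta>\<in>(`) v ` P. span \<beta>)"
      using is_basis unfolding basis_def by auto
  qed
  moreover have "span (v ` K) \<inter> span (\<Union>\<gamma>\<in>(`) v ` P - {v ` K}. span \<gamma>) = {\<zero>\<^bsub>V\<^esub>}"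
    if K: "K \<in> P" for K
  proof -
    let ?U = "\<Union>\<gamma>\<in>(`) v ` P - {v ` K}. span \<gamma>"
    let ?N = "{x \<in> carrier V. \<forall>i\<in>K. \<phi> i x = 0}"
    have UN: "?U \<subseteq> ?N"
    proof clarify
      fix L x assume L: "L \<in> P" "v ` L \<noteq> v ` K" and x: "x \<in> span (v ` L)"
      \<comment> \<open>Different images come from different blocks, and different blocks of a
        partition are disjoint.\<close>
      then have "K \<inter> L = {}" using disjointD[OF partition_onD2[OF assms(2)]] K by metis
      then show "x \<in> carrier V \<and> (\<forall>i\<in>K. \<phi> i x = 0)"
        using x sub[OF K] unfolding span_eq[OF sub[OF L(1)]] by auto
    qed
    have U: "?U \<subseteq> carrier V" by (rule subset_trans[OF UN]) auto
    have N: "span ?U \<subseteq> ?N"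
      by (rule span_is_subset[OF UN vanishing_submodule[OF sub[OF K]]])
    have "x = \<zero>\<^bsub>V\<^esub>" if "x \<in> span (v ` K)" "x \<in> span ?U" for x
      using that N unfolding span_eq[OF sub[OF K]] by (intro sep) auto
    moreover have "\<zero>\<^bsub>V\<^esub> \<in> span (v ` K)" "\<zero>\<^bsub>V\<^esub> \<in> span ?U"
      using submodule.zero_closed[OF span_is_submodule] vK[OF K] U by auto
    ultimately show ?thesis by blast
  qed
  ultimately show ?thesis unfolding is_direct_sum_def by auto
qed

section \<open>The two irreducible modules in a permutation module\<close>

lemma Sn_submoduleI:
  assumes "Sn_module n V \<phi>" "submodule class_ring W V"
    and "\<And>\<sigma> w. \<sigma> permutes {1..n} \<Longrightarrow> w \<in> W \<Longrightarrow> \<phi> \<sigma> w \<in> W"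
  shows "Sn_submodule n V \<phi> W"
  using assms unfolding Sn_submodule_def subspace_def
  by (simp add: Sn_module_def sym_group_carrier)

lemma Sn_submodule_module:
  assumes "Sn_submodule n V \<phi> W"
  shows "Sn_module n (V\<lparr>carrier := W\<rparr>) \<phi>"
proof -
  have V: "Sn_module n V \<phi>" and sub: "VectorSpace.subspace class_ring W V"
    and inv: "\<And>\<sigma> w. \<sigma> \<in> carrier (sym_group n) \<Longrightarrow> w \<in> W \<Longrightarrow> \<phi> \<sigma> w \<in> W"
    using assms unfolding Sn_submodule_def by auto
  interpret vectorspace class_ring V using V unfolding Sn_module_def by blast
  interpret S: submodule class_ring W V using sub unfolding subspace_def by blast
  have "vectorspace class_ring (V\<lparr>carrier := W\<rparr>)" by (rule subspace_is_vs[OF sub])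
  moreover have "\<phi> \<sigma> \<in> LinearCombinations.module_hom class_ring (V\<lparr>carrier := W\<rparr>) (V\<lparr>carrier := W\<rparr>)"
    if "\<sigma> \<in> carrier (sym_group n)" for \<sigma>
  proof -
    have "\<phi> \<sigma> \<in> LinearCombinations.module_hom class_ring V V" using V that unfolding Sn_module_def by blast
    then show ?thesis using inv[OF that] S.subset unfolding LinearCombinations.module_hom_def by (auto simp: subset_iff)
  qed
  ultimately show ?thesis using V S.subset unfolding Sn_module_def by (auto simp: subset_iff)
qed

text \<open>The functional \<open>f\<close> shows that \<open>u\<close> is nonzero and reads off the
  coordinate on the line. The instances are the class of \<open>n! e_1^d\<close> in the quotient and
  the constant 1 in the polynomial ring.\<close>

locale invariant_vector =
  fixes n :: nat and V :: "(complex, 'v) module" and act :: "(nat \<Rightarrow> nat) \<Rightarrow> 'v \<Rightarrow> 'v"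
    and u :: 'v and f :: "'v \<Rightarrow> complex"
  assumes mod: "Sn_module n V act"
    and u_closed: "u \<in> carrier V"
    and act_u: "\<sigma> permutes {1..n} \<Longrightarrow> act \<sigma> u = u"
    and f: "functional V f"
    and f_u: "f u = 1"
begin

sublocale vectorspace class_ring V using mod unfolding Sn_module_def by blast

definition line :: "'v set" where
  "line = {c \<odot>\<^bsub>V\<^esub> u | c. True}"

lemma f_smult_u [simp]: "f (c \<odot>\<^bsub>V\<^esub> u) = c"
  using f u_closed f_u unfolding functional_def by simp

lemma u_in_line: "u \<in> line"
proof -
  have "u = 1 \<odot>\<^bsub>V\<^esub> u" using smult_one[OF u_closed] by simp
  then show ?thesis unfolding line_def by blast
qed

lemma line_submodule: "submodule class_ring line V"
proof
  have "\<zero>\<^bsub>V\<^esub> = 0 \<odot>\<^bsub>V\<^esub> u" using smult_l_null[OF u_closed] by simp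
  then show "\<zero>\<^bsub>V\<^esub> \<in> line" unfolding line_def by blast
  show "x \<oplus>\<^bsub>V\<^esub> y \<in> line" if "x \<in> line" "y \<in> line" for x y
    using that u_closed smult_l_distr[of _ _ u] unfolding line_def by (simp, metis)
  show "c \<odot>\<^bsub>V\<^esub> x \<in> line" if "x \<in> line" for c x
    using that u_closed smult_assoc1[of _ _ u] unfolding line_def by (simp, metis)
qed (use u_closed in \<open>auto simp: line_def\<close>)

lemma act_smult_u:
  assumes "\<sigma> permutes {1..n}"
  shows "act \<sigma> (c \<odot>\<^bsub>V\<^esub> u) = c \<odot>\<^bsub>V\<^esub> u"
proof -
  have "act \<sigma> \<in> LinearCombinations.module_hom class_ring V V"
    using mod assms unfolding Sn_module_def by (simp add: sym_group_carrier)
  then show ?thesis using u_closed act_u[OF assms] unfolding LinearCombinations.module_hom_def by simp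
qed

lemma line_Sn_submodule: "Sn_submodule n V act line"
  by (rule Sn_submoduleI[OF mod line_submodule]) (auto simp: line_def act_smult_u)

lemma line_span: "span {u} = line"
proof
  show "span {u} \<subseteq> line"
    by (rule span_is_subset[OF _ line_submodule])
      (simp add: u_in_line)
  have u: "{u} \<subseteq> carrier V" using u_closed by simp
  show "line \<subseteq> span {u}"
    using in_own_span[OF u] submodule.smult_closed[OF span_is_submodule[OF u]]
    unfolding line_def by auto
qed

lemma line_irreducible: "Sn_irreducible n (V\<lparr>carrier := line\<rparr>) act"
  unfolding Sn_irreducible_def
proof (intro conjI allI impI)
  show "Sn_module n (V\<lparr>carrier := line\<rparr>) act"
    by (rule Sn_submodule_module[OF line_Sn_submodule])
  have "u \<in> line" by (rule u_in_line)
  moreover have "u \<noteq> \<zero>\<^bsub>V\<^esub>" using functional_zero[OF vectorspace_axioms f] f_u by auto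
  ultimately show "carrier (V\<lparr>carrier := line\<rparr>) \<noteq> {\<zero>\<^bsub>V\<lparr>carrier := line\<rparr>\<^esub>}" by auto
  fix W assume "Sn_submodule n (V\<lparr>carrier := line\<rparr>) act W"
  then have W: "submodule class_ring W (V\<lparr>carrier := line\<rparr>)"
    unfolding Sn_submodule_def subspace_def by blast
  have WL: "W \<subseteq> line" and W0: "\<zero>\<^bsub>V\<^esub> \<in> W"
    and Ws: "\<And>c x. x \<in> W \<Longrightarrow> c \<odot>\<^bsub>V\<^esub> x \<in> W"
    using submodule.subset[OF W] submodule.zero_closed[OF W] submodule.smult_closed[OF W] by auto
  have "line \<subseteq> W" if "W \<noteq> {\<zero>\<^bsub>V\<^esub>}"
  proof -
    from that W0 obtain x where x: "x \<in> W" "x \<noteq> \<zero>\<^bsub>V\<^esub>" by auto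
    then obtain c where c: "x = c \<odot>\<^bsub>V\<^esub> u" using WL unfolding line_def by auto
    with x have "c \<noteq> 0" using smult_l_null[OF u_closed] by auto
    then have "d \<odot>\<^bsub>V\<^esub> u = (d / c) \<odot>\<^bsub>V\<^esub> x" for d
      using smult_assoc1[of "d / c" c u] u_closed c by simp
    then show ?thesis using Ws[OF x(1)] unfolding line_def by auto
  qed
  then show "W = {\<zero>\<^bsub>V\<lparr>carrier := line\<rparr>\<^esub>} \<or> W = carrier (V\<lparr>carrier := line\<rparr>)"
    using WL by auto
qed

end

text \<open>Multiplying \<open>u'\<close> by the coordinate \<open>f x\<close> identifies the two
  lines; this is equivariant because every permutation fixes both lines pointwise.\<close>

lemma line_isomorphic:
  assumes "invariant_vector n V act u f" "invariant_vector n V' act' u' f'"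
  shows "Sn_isomorphic n (V\<lparr>carrier := invariant_vector.line V u\<rparr>) act
           (V'\<lparr>carrier := invariant_vector.line V' u'\<rparr>) act'"
proof -
  interpret A: invariant_vector n V act u f by fact
  interpret B: invariant_vector n V' act' u' f' by fact
  let ?h = "\<lambda>x. f x \<odot>\<^bsub>V'\<^esub> u'"
  have "bij_betw ?h A.line B.line"
    by (rule bij_betw_byWitness[of _ "\<lambda>x. f' x \<odot>\<^bsub>V\<^esub> u"]) (auto simp: A.line_def B.line_def)
  moreover have "?h \<in> LinearCombinations.module_hom class_ring (V\<lparr>carrier := A.line\<rparr>) (V'\<lparr>carrier := B.line\<rparr>)"
    using A.f A.u_closed B.u_closed B.smult_l_distr[of _ _ u'] B.smult_assoc1[of _ _ u']
    unfolding LinearCombinations.module_hom_def functional_def A.line_def B.line_def by auto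
  moreover have "?h (act \<sigma> x) = act' \<sigma> (?h x)" if "\<sigma> permutes {1..n}" "x \<in> A.line" for \<sigma> x
    using that by (auto simp: A.line_def A.act_smult_u B.act_smult_u)
  ultimately show ?thesis
    unfolding Sn_isomorphic_def
    using Sn_submodule_module[OF A.line_Sn_submodule] Sn_submodule_module[OF B.line_Sn_submodule]
    by (intro conjI bexI[of _ ?h]) (simp_all add: sym_group_carrier)
qed

text \<open>A copy of the permutation module on \<open>n\<close> letters inside \<open>V\<close>,
  with the \<open>c j\<close> as coordinates. The instances are the classes of \<open>x_j^d\<close>
  with \<open>0 < d < k\<close> in the quotient and the variables in the polynomial ring.\<close>

locale permuted_family =
  fixes n :: nat and V :: "(complex, 'v) module" and act :: "(nat \<Rightarrow> nat) \<Rightarrow> 'v \<Rightarrow> 'v"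
    and y :: "nat \<Rightarrow> 'v" and c :: "nat \<Rightarrow> 'v \<Rightarrow> complex"
  assumes n: "n \<ge> 2"
    and mod: "Sn_module n V act"
    and y_closed: "j \<in> {1..n} \<Longrightarrow> y j \<in> carrier V"
    and act_y: "\<sigma> permutes {1..n} \<Longrightarrow> j \<in> {1..n} \<Longrightarrow> act \<sigma> (y j) = y (\<sigma> j)"
    and c: "j \<in> {1..n} \<Longrightarrow> functional V (c j)"
    and dual: "i \<in> {1..n} \<Longrightarrow> j \<in> {1..n} \<Longrightarrow> c i (y j) = (if i = j then 1 else 0)"
begin

sublocale vectorspace class_ring V using mod unfolding Sn_module_def by blast

definition comb :: "(nat \<Rightarrow> complex) \<Rightarrow> 'v" where
  "comb a = finsum V (\<lambda>j. a j \<odot>\<^bsub>V\<^esub> y j) {1..n}"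

text \<open>The standard representation, of dimension \<open>n - 1\<close>.\<close>

definition std :: "'v set" where
  "std = {comb a | a. (\<Sum>j\<in>{1..n}. a j) = 0}"

definition unit_diff :: "nat \<Rightarrow> nat \<Rightarrow> nat \<Rightarrow> complex" where
  "unit_diff i j l = of_bool (l = i) - of_bool (l = j)"

lemma comb_closed [simp]: "comb a \<in> carrier V"
  unfolding comb_def using y_closed by (intro M.finsum_closed) auto

lemma comb_cong: "(\<And>j. j \<in> {1..n} \<Longrightarrow> a j = b j) \<Longrightarrow> comb a = comb b"
  unfolding comb_def using y_closed by (intro M.finsum_cong') auto

lemma comb_add: "comb a \<oplus>\<^bsub>V\<^esub> comb b = comb (\<lambda>j. a j + b j)"
proof -
  have "comb (\<lambda>j. a j + b j) = finsum V (\<lambda>j. a j \<odot>\<^bsub>V\<^esub> y j \<oplus>\<^bsub>V\<^esub> b j \<odot>\<^bsub>V\<^esub> y j) {1..n}"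
    unfolding comb_def using y_closed smult_l_distr by (intro M.finsum_cong') auto
  also have "\<dots> = comb a \<oplus>\<^bsub>V\<^esub> comb b"
    unfolding comb_def using y_closed by (intro M.finsum_addf) auto
  finally show ?thesis by simp
qed

lemma comb_smult: "d \<odot>\<^bsub>V\<^esub> comb a = comb (\<lambda>j. d * a j)"
proof -
  have "comb (\<lambda>j. d * a j) = finsum V (\<lambda>j. d \<odot>\<^bsub>V\<^esub> (a j \<odot>\<^bsub>V\<^esub> y j)) {1..n}"
    unfolding comb_def using y_closed smult_assoc1 by (intro M.finsum_cong') auto
  also have "\<dots> = d \<odot>\<^bsub>V\<^esub> comb a"
    unfolding comb_def using y_closed by (intro finsum_smult[symmetric]) auto
  finally show ?thesis by simp
qed

lemma comb_zero: "comb (\<lambda>_. 0) = \<zero>\<^bsub>V\<^esub>"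
  using comb_smult[of 0 "\<lambda>_. 0"] smult_l_null[OF comb_closed[of "\<lambda>_. 0"]] by simp

lemma c_comb:
  assumes i: "i \<in> {1..n}"
  shows "c i (comb a) = a i"
proof -
  have "c i (comb a) = (\<Sum>j\<in>{1..n}. c i (a j \<odot>\<^bsub>V\<^esub> y j))"
    unfolding comb_def using y_closed
    by (intro functional_finsum[OF vectorspace_axioms c[OF i]]) auto
  also have "\<dots> = (\<Sum>j\<in>{1..n}. if i = j then a j else 0)"
    using c[OF i] y_closed dual[OF i] unfolding functional_def by (intro sum.cong) auto
  also have "\<dots> = a i" using i by simp
  finally show ?thesis .
qed

lemma comb_c_comb [simp]: "comb (\<lambda>j. c j (comb a)) = comb a"
  by (rule comb_cong) (rule c_comb)

lemma comb_unit:
  assumes i: "i \<in> {1..n}"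
  shows "comb (\<lambda>j. of_bool (j = i)) = y i"
proof -
  have "comb (\<lambda>j. of_bool (j = i)) = finsum V (\<lambda>j. if i = j then y j else \<zero>\<^bsub>V\<^esub>) {1..n}"
    unfolding comb_def using y_closed
    by (intro M.finsum_cong') (auto simp: vectorspace_smult_simps[OF vectorspace_axioms])
  also have "\<dots> = y i" using y_closed by (intro M.finsum_singleton i) auto
  finally show ?thesis .
qed

lemma comb_unit_diff:
  assumes "i \<in> {1..n}" "j \<in> {1..n}"
  shows "comb (unit_diff i j) = y i \<ominus>\<^bsub>V\<^esub> y j"
proof -
  have "comb (unit_diff i j) \<oplus>\<^bsub>V\<^esub> y j = y i"
    unfolding comb_unit[OF assms(1), symmetric] comb_unit[OF assms(2), symmetric] comb_add
    by (simp add: unit_diff_def)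
  then show ?thesis
    using y_closed assms by (metis M.minus_eq M.a_assoc M.r_neg M.r_zero comb_closed M.a_inv_closed)
qed

text \<open>The coefficient of \<open>y j\<close> moves to \<open>y (\<sigma> j)\<close>, so the new
  coefficient at an index is the old one at its preimage.\<close>

lemma act_comb:
  assumes s: "\<sigma> permutes {1..n}"
  shows "act \<sigma> (comb a) = comb (a \<circ> inv' \<sigma>)"
proof -
  have "act \<sigma> \<in> LinearCombinations.module_hom class_ring V V"
    using mod s unfolding Sn_module_def by (simp add: sym_group_carrier)
  then have hom_closed: "act \<sigma> x \<in> carrier V"
    and hom_add: "act \<sigma> (x \<oplus>\<^bsub>V\<^esub> z) = act \<sigma> x \<oplus>\<^bsub>V\<^esub> act \<sigma> z"
    and hom_smult: "act \<sigma> (d \<odot>\<^bsub>V\<^esub> x) = d \<odot>\<^bsub>V\<^esub> act \<sigma> x"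
    if "x \<in> carrier V" and "z \<in> carrier V" for x z d
    using that unfolding LinearCombinations.module_hom_def by auto
  have im: "\<sigma> ` {1..n} = {1..n}" by (rule permutes_image[OF s])
  have inj: "inj \<sigma>" by (rule permutes_inj[OF s])
  have sj: "\<sigma> j \<in> {1..n}" if "j \<in> {1..n}" for j using im that by auto
  have ysj: "y (\<sigma> j) \<in> carrier V" if "j \<in> {1..n}" for j using y_closed sj that by blast
  let ?g = "\<lambda>l. a (inv' \<sigma> l) \<odot>\<^bsub>V\<^esub> y l"
  \<comment> \<open>Linearity is passed through the sum by induction over subsets \<open>A\<close>;
    reindexing by \<sigma> has to wait for the full index set, which \<sigma> maps onto
    itself.\<close>
  have act_sum: "act \<sigma> (finsum V (\<lambda>j. a j \<odot>\<^bsub>V\<^esub> y j) A) = finsum V (\<lambda>j. a j \<odot>\<^bsub>V\<^esub> y (\<sigma> j)) A"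
    if "finite A" "A \<subseteq> {1..n}" for A
    using that
  proof (induction A)
    case (insert i A)
    then have i: "i \<in> {1..n}" and A: "A \<subseteq> {1..n}" by auto
    have g: "(\<lambda>j. a j \<odot>\<^bsub>V\<^esub> y j) \<in> A \<rightarrow> carrier V" "(\<lambda>j. a j \<odot>\<^bsub>V\<^esub> y (\<sigma> j)) \<in> A \<rightarrow> carrier V"
      "a i \<odot>\<^bsub>V\<^esub> y i \<in> carrier V" "a i \<odot>\<^bsub>V\<^esub> y (\<sigma> i) \<in> carrier V"
      using A i y_closed ysj by auto
    have sums: "finsum V (\<lambda>j. a j \<odot>\<^bsub>V\<^esub> y j) A \<in> carrier V"
      using g(1) by (rule M.finsum_closed)
    have "act \<sigma> (finsum V (\<lambda>j. a j \<odot>\<^bsub>V\<^esub> y j) (insert i A)) =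
        act \<sigma> (a i \<odot>\<^bsub>V\<^esub> y i \<oplus>\<^bsub>V\<^esub> finsum V (\<lambda>j. a j \<odot>\<^bsub>V\<^esub> y j) A)"
      by (simp only: M.finsum_insert[OF insert.hyps g(1,3)])
    also have "\<dots> = a i \<odot>\<^bsub>V\<^esub> y (\<sigma> i) \<oplus>\<^bsub>V\<^esub> finsum V (\<lambda>j. a j \<odot>\<^bsub>V\<^esub> y (\<sigma> j)) A"
      by (simp only: hom_add[OF g(3) sums] hom_smult[OF y_closed[OF i] y_closed[OF i]] insert.IH[OF A] act_y[OF s i])
    also have "\<dots> = finsum V (\<lambda>j. a j \<odot>\<^bsub>V\<^esub> y (\<sigma> j)) (insert i A)"
      by (simp only: M.finsum_insert[OF insert.hyps g(2,4)])
    finally show ?case .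
  next
    case empty
    have "act \<sigma> (0 \<odot>\<^bsub>V\<^esub> \<zero>\<^bsub>V\<^esub>) = 0 \<odot>\<^bsub>V\<^esub> act \<sigma> \<zero>\<^bsub>V\<^esub>"
      by (rule hom_smult[OF M.zero_closed M.zero_closed])
    then show ?case
      using vectorspace_smult_simps(2)[OF vectorspace_axioms] hom_closed[of "\<zero>\<^bsub>V\<^esub>" "\<zero>\<^bsub>V\<^esub>"] by simp
  qed
  have "act \<sigma> (comb a) = finsum V (\<lambda>j. a j \<odot>\<^bsub>V\<^esub> y (\<sigma> j)) {1..n}"
    unfolding comb_def by (rule act_sum) auto
  also have "\<dots> = finsum V (\<lambda>j. ?g (\<sigma> j)) {1..n}"
    by (simp only: inv_f_f[OF inj])
  also have "\<dots> = finsum V ?g (\<sigma> ` {1..n})"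
  proof (rule M.finsum_reindex[of ?g \<sigma> "{1..n}", symmetric])
    show "?g \<in> \<sigma> ` {1..n} \<rightarrow> carrier V" unfolding im by (rule Pi_I) (simp add: y_closed)
    show "inj_on \<sigma> {1..n}" by (rule permutes_inj_on[OF s])
  qed
  also have "\<dots> = comb (a \<circ> inv' \<sigma>)" unfolding comb_def im by simp
  finally show ?thesis .
qed

lemma unit_diff_sum: "i \<in> {1..n} \<Longrightarrow> j \<in> {1..n} \<Longrightarrow> (\<Sum>l\<in>{1..n}. unit_diff i j l) = 0"
  by (simp add: unit_diff_def sum_subtractf of_bool_def)

lemma std_submodule: "submodule class_ring std V"
proof
  show "\<zero>\<^bsub>V\<^esub> \<in> std" unfolding std_def
    by (intro CollectI exI[of _ "\<lambda>_. 0"]) (simp add: comb_zero)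
  show "v \<oplus>\<^bsub>V\<^esub> w \<in> std" if "v \<in> std" "w \<in> std" for v w
  proof -
    from that obtain a b where "v = comb a" "w = comb b" "(\<Sum>j\<in>{1..n}. a j) = 0" "(\<Sum>j\<in>{1..n}. b j) = 0"
      unfolding std_def by auto
    then show ?thesis unfolding std_def
      by (intro CollectI exI[of _ "\<lambda>j. a j + b j"]) (simp add: comb_add sum.distrib)
  qed
  show "d \<odot>\<^bsub>V\<^esub> w \<in> std" if "w \<in> std" for d w
  proof -
    from that obtain a where "w = comb a" "(\<Sum>j\<in>{1..n}. a j) = 0"
      unfolding std_def by auto
    then show ?thesis unfolding std_def
      by (intro CollectI exI[of _ "\<lambda>j. d * a j"]) (simp add: comb_smult sum_distrib_left[symmetric])
  qed
qed (auto simp: std_def)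

lemma std_Sn_submodule: "Sn_submodule n V act std"
proof (rule Sn_submoduleI[OF mod std_submodule])
  fix \<sigma> w assume s: "\<sigma> permutes {1..n}" and "w \<in> std"
  then obtain a where a: "w = comb a" "(\<Sum>j\<in>{1..n}. a j) = 0" unfolding std_def by auto
  have "(\<Sum>j\<in>{1..n}. (a \<circ> inv' \<sigma>) j) = (\<Sum>j\<in>{1..n}. a j)"
    using sum.permute[OF permutes_inv[OF s], of a] by simp
  then show "act \<sigma> w \<in> std" using a act_comb[OF s] unfolding std_def by auto
qed

text \<open>A sum-zero vector \<open>a\<close> is the combination, over \<open>b \<ge> 2\<close>, of
  the \<open>b\<close>-th minus the first unit vector with coefficient \<open>a b\<close>: the first
  coordinate comes out as \<open>- (a 2 + ... + a n)\<close>, which is \<open>a 1\<close>.\<close>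

lemma std_subset:
  assumes W: "submodule class_ring W V"
    and d: "\<And>b. b \<in> {2..n} \<Longrightarrow> comb (unit_diff b 1) \<in> W"
  shows "std \<subseteq> W"
proof
  fix x assume "x \<in> std"
  then obtain a where a: "x = comb a" "(\<Sum>j\<in>{1..n}. a j) = 0" unfolding std_def by auto
  have part: "comb (\<lambda>j. \<Sum>b\<in>B. a b * unit_diff b 1 j) \<in> W" if "finite B" "B \<subseteq> {2..n}" for B
    using that
  proof (induction B)
    case empty
    then show ?case using submodule.zero_closed[OF W] comb_zero by simp
  next
    case (insert b B)
    have "comb (\<lambda>j. \<Sum>b\<in>insert b B. a b * unit_diff b 1 j) =
        a b \<odot>\<^bsub>V\<^esub> comb (unit_diff b 1) \<oplus>\<^bsub>V\<^esub> comb (\<lambda>j. \<Sum>b\<in>B. a b * unit_diff b 1 j)"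
      using insert by (simp add: comb_smult comb_add)
    then show ?case using insert d submodule.m_closed[OF W] submodule.smult_closed[OF W] by simp
  qed
  have split: "{1..n} = insert 1 {2..n}" using n by auto
  have "x = comb (\<lambda>j. \<Sum>b\<in>{2..n}. a b * unit_diff b 1 j)"
    unfolding a(1)
  proof (rule comb_cong)
    fix j assume j: "j \<in> {1..n}"
    have "(\<Sum>b\<in>{2..n}. a b * unit_diff b 1 j) = a j" if "j \<noteq> 1"
    proof -
      have "(\<Sum>b\<in>{2..n}. a b * unit_diff b 1 j) = (\<Sum>b\<in>{2..n}. if j = b then a b else 0)"
        using that by (intro sum.cong) (auto simp: unit_diff_def)
      then show ?thesis using that j by auto
    qed
    moreover have "(\<Sum>b\<in>{2..n}. a b * unit_diff b 1 1) = a 1"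
    proof -
      have "(\<Sum>b\<in>{2..n}. a b * unit_diff b 1 1) = - (\<Sum>b\<in>{2..n}. a b)"
        unfolding sum_negf[symmetric] by (intro sum.cong) (auto simp: unit_diff_def)
      moreover have "a 1 + (\<Sum>b\<in>{2..n}. a b) = 0" using a(2) unfolding split by simp
      ultimately show ?thesis by (simp add: add_eq_0_iff)
    qed
    ultimately show "a j = (\<Sum>b\<in>{2..n}. a b * unit_diff b 1 j)" by (cases "j = 1") auto
  qed
  then show "x \<in> W" using part[of "{2..n}"] by simp
qed

lemma span_eq_std:
  assumes "A \<subseteq> std" "\<And>b. b \<in> {2..n} \<Longrightarrow> y b \<ominus>\<^bsub>V\<^esub> y 1 \<in> span A"
  shows "span A = std"
proof
  show "span A \<subseteq> std" by (rule span_is_subset[OF assms(1) std_submodule])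
  have "A \<subseteq> carrier V" using assms(1) submodule.subset[OF std_submodule] by auto
  then show "std \<subseteq> span A"
    using assms(2) n by (intro std_subset span_is_submodule) (auto simp: comb_unit_diff)
qed

text \<open>If \<open>a i\<close> and \<open>a j\<close> differ, subtracting the image under the
  transposition of \<open>i\<close> and \<open>j\<close> and dividing by \<open>a i - a j\<close>
  isolates a difference of two unit vectors. Double transitivity moves it to any other such
  difference.\<close>

lemma unit_diff_in_invariant:
  assumes W: "submodule class_ring W V" and act: "\<And>\<sigma> w. \<sigma> permutes {1..n} \<Longrightarrow> w \<in> W \<Longrightarrow> act \<sigma> w \<in> W"
    and x: "comb a \<in> W" and ij: "i \<in> {1..n}" "j \<in> {1..n}" "a i \<noteq> a j" and b: "b \<in> {2..n}"
  shows "comb (unit_diff b 1) \<in> W"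
proof -
  let ?t = "transpose i j"
  have neq: "i \<noteq> j" using ij by auto
  have t: "?t permutes {1..n}" using ij by (intro permutes_swap_id) auto
  have "comb (a \<circ> ?t) \<in> W" using act[OF t x] act_comb[OF t, of a] by simp
  then have "(1 / (a i - a j)) \<odot>\<^bsub>V\<^esub> (comb a \<oplus>\<^bsub>V\<^esub> (-1) \<odot>\<^bsub>V\<^esub> comb (a \<circ> ?t)) \<in> W"
    using x submodule.m_closed[OF W] submodule.smult_closed[OF W] by simp
  also have "(1 / (a i - a j)) \<odot>\<^bsub>V\<^esub> (comb a \<oplus>\<^bsub>V\<^esub> (-1) \<odot>\<^bsub>V\<^esub> comb (a \<circ> ?t)) = comb (unit_diff i j)"
    unfolding comb_smult comb_add
    using ij neq by (intro comb_cong) (auto simp: unit_diff_def transpose_def field_simps)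
  finally have d: "comb (unit_diff i j) \<in> W" .
  have "b \<in> {1..n}" "1 \<in> {1..n}" "b \<noteq> 1" using b by auto
  then obtain \<sigma> where s: "\<sigma> permutes {1..n}" "\<sigma> i = b" "\<sigma> j = 1"
    using permutes_pair_exists[OF ij(1,2) neq, of b 1] by auto
  have "unit_diff i j \<circ> inv' \<sigma> = unit_diff b 1"
    using s by (auto simp: unit_diff_def fun_eq_iff permutes_inverses permutes_inv_eq)
  then show ?thesis using act[OF s(1) d] act_comb[OF s(1)] by simp
qed

text \<open>A nonzero invariant subspace contains a vector with two different coefficients, hence by
  \<open>unit_diff_in_invariant\<close> all the differences that span \<open>std\<close>.\<close>

lemma std_irreducible: "Sn_irreducible n (V\<lparr>carrier := std\<rparr>) act"
  unfolding Sn_irreducible_def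
proof (intro conjI allI impI)
  show "Sn_module n (V\<lparr>carrier := std\<rparr>) act"
    by (rule Sn_submodule_module[OF std_Sn_submodule])
  have two: "2 \<in> {1..n}" "1 \<in> {1..n}" using n by auto
  have "comb (unit_diff 2 1) \<in> std" using unit_diff_sum[OF two] unfolding std_def by auto
  moreover have "c 2 (comb (unit_diff 2 1)) = 1" using two by (simp add: c_comb unit_diff_def)
  ultimately show "carrier (V\<lparr>carrier := std\<rparr>) \<noteq> {\<zero>\<^bsub>V\<lparr>carrier := std\<rparr>\<^esub>}"
    using functional_zero[OF vectorspace_axioms c[OF two(1)]] by auto
  fix W assume "Sn_submodule n (V\<lparr>carrier := std\<rparr>) act W"
  then have W: "submodule class_ring W (V\<lparr>carrier := std\<rparr>)"
    and act: "\<And>\<sigma> w. \<sigma> permutes {1..n} \<Longrightarrow> w \<in> W \<Longrightarrow> act \<sigma> w \<in> W"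
    unfolding Sn_submodule_def subspace_def by (simp_all add: sym_group_carrier)
  have WS: "W \<subseteq> std" and W0: "\<zero>\<^bsub>V\<^esub> \<in> W"
    using submodule.subset[OF W] submodule.zero_closed[OF W] by auto
  have WV: "submodule class_ring W V"
  proof (rule submodule.intro)
    show "W \<subseteq> carrier V" using WS submodule.subset[OF std_submodule] by blast
  qed (use submodule.module[OF std_submodule] W0 submodule.m_closed[OF W] submodule.smult_closed[OF W]
    in simp_all)
  have "std \<subseteq> W" if ne: "W \<noteq> {\<zero>\<^bsub>V\<^esub>}"
  proof -
    from ne W0 obtain x where x: "x \<in> W" "x \<noteq> \<zero>\<^bsub>V\<^esub>" by auto
    then obtain a where a: "x = comb a" "(\<Sum>j\<in>{1..n}. a j) = 0" using WS unfolding std_def by auto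
    \<comment> \<open>Otherwise all coefficients equal \<open>a 1\<close>, and since their sum
      \<open>n * a 1\<close> is zero they all vanish, contrary to the choice of
      \<open>x\<close>.\<close>
    have "\<exists>i\<in>{1..n}. a i \<noteq> a 1"
    proof (rule ccontr)
      assume "\<not> ?thesis"
      then have eq: "\<And>i. i \<in> {1..n} \<Longrightarrow> a i = a 1" by blast
      have "(\<Sum>j\<in>{1..n}. a j) = (\<Sum>j\<in>{1..n}. a 1)" by (rule sum.cong[OF refl eq])
      then have "of_nat n * a 1 = 0" using a(2) by simp
      then have "a 1 = 0" using n by simp
      then have "a i = 0" if "i \<in> {1..n}" for i using eq[OF that] by simp
      then have "comb a = comb (\<lambda>_. 0)" by (rule comb_cong)
      then show False using x a comb_zero by simp
    qed
    then obtain i where i: "i \<in> {1..n}" "a i \<noteq> a 1" by auto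
    have "comb a \<in> W" using x a by simp
    from unit_diff_in_invariant[OF WV act this i(1) two(2) i(2)] show ?thesis
      by (rule std_subset[OF WV])
  qed
  then show "W = {\<zero>\<^bsub>V\<lparr>carrier := std\<rparr>\<^esub>} \<or> W = carrier (V\<lparr>carrier := std\<rparr>)"
    using WS by auto
qed

end

text \<open>Coefficient vectors are copied from one family to the other. By \<open>act_comb\<close>
  the action has the same formula on both sides, so the map is equivariant.\<close>

lemma std_isomorphic:
  assumes "permuted_family n V act y c" "permuted_family n V' act' y' c'"
  shows "Sn_isomorphic n (V\<lparr>carrier := permuted_family.std n V y\<rparr>) act
           (V'\<lparr>carrier := permuted_family.std n V' y'\<rparr>) act'"
proof -
  interpret A: permuted_family n V act y c by fact
  interpret B: permuted_family n V' act' y' c' by fact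
  let ?h = "\<lambda>x. B.comb (\<lambda>j. c j x)"
  have h: "?h (A.comb a) = B.comb a" for a by (rule B.comb_cong) (rule A.c_comb)
  have h': "A.comb (\<lambda>j. c' j (B.comb a)) = A.comb a" for a
    by (rule A.comb_cong) (rule B.c_comb)
  have "bij_betw ?h A.std B.std"
    by (rule bij_betw_byWitness[of _ "\<lambda>x. A.comb (\<lambda>j. c' j x)"])
      (auto simp: A.std_def B.std_def h h')
  moreover have "?h \<in> LinearCombinations.module_hom class_ring (V\<lparr>carrier := A.std\<rparr>) (V'\<lparr>carrier := B.std\<rparr>)"
    unfolding LinearCombinations.module_hom_def
    by (auto simp: A.std_def B.std_def h A.comb_add A.comb_smult)
      (simp_all add: B.comb_add B.comb_smult)
  moreover have "?h (act \<sigma> x) = act' \<sigma> (?h x)" if "\<sigma> permutes {1..n}" "x \<in> A.std" for \<sigma> x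
  proof -
    from that obtain a where "x = A.comb a" by (auto simp: A.std_def)
    then show ?thesis using that(1) by (simp add: h A.act_comb B.act_comb)
  qed
  ultimately show ?thesis
    unfolding Sn_isomorphic_def
    using Sn_submodule_module[OF A.std_Sn_submodule] Sn_submodule_module[OF B.std_Sn_submodule]
    by (intro conjI bexI[of _ ?h]) (simp_all add: sym_group_carrier)
qed

section \<open>The polynomial algebra as a module over the symmetric group\<close>

lemma poly_alg_simps [simp]:
  "monoid.mult (poly_alg n) = (*)" "one (poly_alg n) = 1" "zero (poly_alg n) = 0"
  "add (poly_alg n) = (+)" "module.smult (poly_alg n) = (\<lambda>c f. Const c * f)"
  by (simp_all add: poly_alg_def)

lemma poly_alg_carrier:
  "f \<in> carrier (poly_alg n) \<longleftrightarrow> (\<forall>m\<in>Poly_Mapping.keys f. Poly_Mapping.keys m \<subseteq> {1..n})"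
  by (simp add: poly_alg_def)

lemma lookup_single_mult:
  fixes g :: "('a::monoid_add \<Rightarrow>\<^sub>0 'b::semiring_0)"
  shows "Poly_Mapping.lookup (Poly_Mapping.single s c * g) m =
    c * (\<Sum>q. Poly_Mapping.lookup g q when m = s + q)"
proof -
  have "Poly_Mapping.lookup (Poly_Mapping.single s c * g) m =
    (\<Sum>l. c * (\<Sum>q. Poly_Mapping.lookup g q when m = l + q) when s = l)"
    unfolding lookup_mult lookup_single by (rule Sum_any.cong) (simp add: when_def)
  then show ?thesis by simp
qed

lemma lookup_Const_mult: "Poly_Mapping.lookup (Const c * f) m = c * Poly_Mapping.lookup f m"
  unfolding Const_def lookup_single_mult by simp

lemma Const_simps:
  "Const (a + b) = Const a + Const b" "Const (a * b) = Const a * Const b" "Const 1 = 1" "Const 0 = 0"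
  by (simp_all add: Const_def single_add mult_single)

lemma Const_of_nat: "Const (of_nat a) = of_nat a"
  by (simp add: Const_def)

lemma poly_alg_closed [simp]:
  "0 \<in> carrier (poly_alg n)" "1 \<in> carrier (poly_alg n)" "Const c \<in> carrier (poly_alg n)"
  "i \<in> {1..n} \<Longrightarrow> Var i \<in> carrier (poly_alg n)"
  "f \<in> carrier (poly_alg n) \<Longrightarrow> - f \<in> carrier (poly_alg n)"
  "f \<in> carrier (poly_alg n) \<Longrightarrow> g \<in> carrier (poly_alg n) \<Longrightarrow> f + g \<in> carrier (poly_alg n)"
  "f \<in> carrier (poly_alg n) \<Longrightarrow> g \<in> carrier (poly_alg n) \<Longrightarrow> f * g \<in> carrier (poly_alg n)"
proof -
  show "f + g \<in> carrier (poly_alg n)" if "f \<in> carrier (poly_alg n)" "g \<in> carrier (poly_alg n)"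
    using that keys_add[of f g] unfolding poly_alg_carrier by blast
  show "f * g \<in> carrier (poly_alg n)" if "f \<in> carrier (poly_alg n)" "g \<in> carrier (poly_alg n)"
    unfolding poly_alg_carrier
  proof
    fix m assume "m \<in> Poly_Mapping.keys (f * g)"
    then obtain a b where "m = a + b" "a \<in> Poly_Mapping.keys f" "b \<in> Poly_Mapping.keys g"
      using keys_mult[of f g] by blast
    then show "Poly_Mapping.keys m \<subseteq> {1..n}"
      using that keys_add[of a b] unfolding poly_alg_carrier by blast
  qed
qed (auto simp: poly_alg_carrier Const_def Var_def in_keys_iff)

lemma poly_alg_diff [simp]:
  "f \<in> carrier (poly_alg n) \<Longrightarrow> g \<in> carrier (poly_alg n) \<Longrightarrow> f - g \<in> carrier (poly_alg n)"
  using poly_alg_closed(6)[OF _ poly_alg_closed(5)] by simp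

lemma poly_alg_sum [simp]:
  "(\<And>a. a \<in> A \<Longrightarrow> f a \<in> carrier (poly_alg n)) \<Longrightarrow> sum f A \<in> carrier (poly_alg n)"
  by (induction A rule: infinite_finite_induct) auto

lemma poly_alg_prod [simp]:
  "(\<And>a. a \<in> A \<Longrightarrow> f a \<in> carrier (poly_alg n)) \<Longrightarrow> prod f A \<in> carrier (poly_alg n)"
  by (induction A rule: infinite_finite_induct) auto

lemma poly_alg_power [simp]: "f \<in> carrier (poly_alg n) \<Longrightarrow> f ^ i \<in> carrier (poly_alg n)"
  by (induction i) auto

lemma poly_alg_of_nat [simp]: "of_nat a \<in> carrier (poly_alg n)"
  using poly_alg_closed(3)[where c="of_nat a"] by (simp add: Const_of_nat)

lemma poly_alg_cring: "cring (poly_alg n)"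
proof (intro cringI abelian_groupI comm_monoidI)
  fix x assume "x \<in> carrier (poly_alg n)"
  then show "\<exists>y\<in>carrier (poly_alg n). y \<oplus>\<^bsub>poly_alg n\<^esub> x = \<zero>\<^bsub>poly_alg n\<^esub>"
    by (intro bexI[of _ "- x"]) auto
qed (simp_all add: algebra_simps)

lemma poly_alg_vectorspace: "vectorspace class_ring (poly_alg n)"
proof (rule vs_criteria)
  show "field (class_ring :: complex ring)" by (rule class_field.field_axioms)
  show "\<forall>v\<in>carrier (poly_alg n). \<exists>neg_v\<in>carrier (poly_alg n). v \<oplus>\<^bsub>poly_alg n\<^esub> neg_v = \<zero>\<^bsub>poly_alg n\<^esub>"
    by (auto intro: bexI[of _ "- v" for v])
qed (auto simp: Const_simps algebra_simps)

lemma lookup_perm_poly: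
  assumes "bij \<sigma>"
  shows "Poly_Mapping.lookup (perm_poly \<sigma> f) m = Poly_Mapping.lookup f (Poly_Mapping.map_key \<sigma> m)"
  unfolding perm_poly_def using inj_map_key[OF assms] by (simp add: map_key.rep_eq)

lemma perm_poly_add: "bij \<sigma> \<Longrightarrow> perm_poly \<sigma> (f + g) = perm_poly \<sigma> f + perm_poly \<sigma> g"
  by (rule poly_mapping_eqI) (simp add: lookup_perm_poly lookup_add)

lemma perm_poly_Const_mult: "bij \<sigma> \<Longrightarrow> perm_poly \<sigma> (Const c * f) = Const c * perm_poly \<sigma> f"
  by (rule poly_mapping_eqI) (simp add: lookup_perm_poly lookup_Const_mult)

lemma perm_poly_id: "perm_poly id f = f"
  by (rule poly_mapping_eqI) (simp add: lookup_perm_poly[OF bij_id] map_key_id[folded id_def])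

lemma perm_poly_comp:
  assumes "bij \<sigma>" "bij \<tau>"
  shows "perm_poly (\<sigma> \<circ> \<tau>) f = perm_poly \<sigma> (perm_poly \<tau> f)"
  using assms
  by (intro poly_mapping_eqI) (simp add: lookup_perm_poly bij_comp map_key_compose bij_is_inj)

lemma perm_poly_1: "bij \<sigma> \<Longrightarrow> perm_poly \<sigma> 1 = 1"
proof (rule poly_mapping_eqI)
  fix m :: "nat \<Rightarrow>\<^sub>0 nat" assume b: "bij \<sigma>"
  have "Poly_Mapping.map_key \<sigma> m = 0 \<longleftrightarrow> m = 0"
    using inj_eq[OF inj_map_key[OF b], of m 0] b by (simp add: bij_is_inj)
  then show "Poly_Mapping.lookup (perm_poly \<sigma> 1) m = Poly_Mapping.lookup 1 m"
    using b by (simp add: lookup_perm_poly lookup_one when_def)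
qed

lemma map_key_single_inv:
  assumes "bij \<sigma>"
  shows "Poly_Mapping.map_key \<sigma> (Poly_Mapping.single j d) = Poly_Mapping.single (inv' \<sigma> j) d"
  using map_key_single[OF bij_is_inj[OF assms], of "inv' \<sigma> j" d]
  by (simp add: surj_f_inv_f[OF bij_is_surj[OF assms]])

lemma perm_poly_closed:
  assumes s: "\<sigma> permutes {1..n}" and f: "f \<in> carrier (poly_alg n)"
  shows "perm_poly \<sigma> f \<in> carrier (poly_alg n)"
  unfolding poly_alg_carrier
proof
  fix m assume m: "m \<in> Poly_Mapping.keys (perm_poly \<sigma> f)"
  have b: "bij \<sigma>" using s by (rule permutes_bij)
  from m have "Poly_Mapping.map_key \<sigma> m \<in> Poly_Mapping.keys f"
    by (simp add: in_keys_iff lookup_perm_poly[OF b])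
  then have *: "\<sigma> -` Poly_Mapping.keys m \<subseteq> {1..n}"
    using f keys_map_key[OF bij_is_inj[OF b]] unfolding poly_alg_carrier by metis
  show "Poly_Mapping.keys m \<subseteq> {1..n}"
  proof
    fix x assume x: "x \<in> Poly_Mapping.keys m"
    have "\<sigma> (inv' \<sigma> x) = x" by (rule permutes_inverses(1)[OF s])
    with x * have "inv' \<sigma> x \<in> {1..n}" by auto
    then show "x \<in> {1..n}" using permutes_in_image[OF permutes_inv[OF s]] by blast
  qed
qed

lemma poly_alg_Sn_module: "Sn_module n (poly_alg n) perm_poly"
  unfolding Sn_module_def LinearCombinations.module_hom_def
  by (auto simp: poly_alg_vectorspace sym_group_carrier permutes_bij perm_poly_closed perm_poly_add
      perm_poly_Const_mult perm_poly_id perm_poly_comp)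

section \<open>Griffin's ideal\<close>

text \<open>Exponents are natural numbers and add pointwise, so neither summand can be nonzero away
  from \<open>j\<close>. This is why the coefficients of a product on an axis depend only on the
  coefficients of its factors on that axis.\<close>

lemma single_eq_add:
  fixes l q :: "'a \<Rightarrow>\<^sub>0 nat"
  assumes "Poly_Mapping.single j d = l + q"
  shows "\<exists>e\<le>d. l = Poly_Mapping.single j e"
proof (intro exI conjI)
  have eq: "Poly_Mapping.lookup l i + Poly_Mapping.lookup q i = (d when j = i)" for i
    using arg_cong[OF assms, of "\<lambda>p. Poly_Mapping.lookup p i"] by (simp add: lookup_add lookup_single)
  show "Poly_Mapping.lookup l j \<le> d" using eq[of j] by simp
  show "l = Poly_Mapping.single j (Poly_Mapping.lookup l j)"
  proof (rule poly_mapping_eqI)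
    fix i
    show "Poly_Mapping.lookup l i = Poly_Mapping.lookup (Poly_Mapping.single j (Poly_Mapping.lookup l j)) i"
      using eq[of i] by (cases "j = i") (simp_all add: lookup_single)
  qed
qed

lemma single_eq_single_iff:
  fixes d e :: nat
  shows "Poly_Mapping.single i d = Poly_Mapping.single j e \<longleftrightarrow> d = e \<and> (d = 0 \<or> i = j)"
proof
  assume eq: "Poly_Mapping.single i d = Poly_Mapping.single j e"
  show "d = e \<and> (d = 0 \<or> i = j)"
    using arg_cong[OF eq, of "\<lambda>p. Poly_Mapping.lookup p i"]
      arg_cong[OF eq, of "\<lambda>p. Poly_Mapping.lookup p j"]
    by (auto simp: lookup_single when_def split: if_splits)
qed auto

text \<open>Seen on the powers of \<open>x_j\<close> alone, multiplication by \<open>x_j\<close> is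
  a shift and multiplication by any other variable is zero.\<close>

lemma lookup_Var_mult_axis:
  "Poly_Mapping.lookup (Var i * g) (Poly_Mapping.single j d) =
    (if i = j \<and> d > 0 then Poly_Mapping.lookup g (Poly_Mapping.single j (d - 1)) else 0)"
proof (cases "i = j \<and> d > 0")
  case True
  then have "Poly_Mapping.single j d = Poly_Mapping.single i 1 + Poly_Mapping.single j (d - 1)"
    by (simp flip: single_add)
  then have "Poly_Mapping.single j d = Poly_Mapping.single i 1 + q \<longleftrightarrow> q = Poly_Mapping.single j (d - 1)"
    for q by auto
  with True show ?thesis unfolding Var_def lookup_single_mult by simp
next
  case False
  have "Poly_Mapping.single j d \<noteq> Poly_Mapping.single i 1 + q" for q
    using False single_eq_add[of j d "Poly_Mapping.single i 1" q] by (auto simp: single_eq_single_iff)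
  with False show ?thesis unfolding Var_def lookup_single_mult by auto
qed

lemma Var_power: "Var i ^ r = Poly_Mapping.single (Poly_Mapping.single i r) 1"
  by (induction r) (simp_all add: Var_def mult_single flip: single_add)

definition axis_ideal :: "nat \<Rightarrow> nat \<Rightarrow> mpoly set" where
  "axis_ideal n k = {f \<in> carrier (poly_alg n).
     \<forall>j\<in>{1..n}. \<forall>d<k. Poly_Mapping.lookup f (Poly_Mapping.single j d) = 0}"

text \<open>The coefficient of the product at \<open>x_j^d\<close> only involves coefficients of
  \<open>f\<close> at divisors \<open>x_j^e\<close> with \<open>e \<le> d < k\<close>, and these
  vanish.\<close>

lemma axis_ideal_mult:
  assumes f: "f \<in> axis_ideal n k" and g: "g \<in> carrier (poly_alg n)"
  shows "f * g \<in> axis_ideal n k"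
proof -
  have "Poly_Mapping.lookup (f * g) (Poly_Mapping.single j d) = 0" if j: "j \<in> {1..n}" and d: "d < k" for j d
  proof -
    have zero: "Poly_Mapping.lookup f l * (\<Sum>q. Poly_Mapping.lookup g q when Poly_Mapping.single j d = l + q) = 0" for l
    proof (cases "\<exists>q. Poly_Mapping.single j d = l + q")
      case True
      then obtain q where "Poly_Mapping.single j d = l + q" by auto
      from single_eq_add[OF this] obtain e where "e \<le> d" "l = Poly_Mapping.single j e" by auto
      moreover from this(1) d have "e < k" by simp
      ultimately have "Poly_Mapping.lookup f l = 0" using f j unfolding axis_ideal_def by blast
      then show ?thesis by simp
    qed simp
    show ?thesis unfolding lookup_mult zero by simp
  qed
  then show ?thesis using f g unfolding axis_ideal_def by auto
qed

lemma poly_alg_a_inv: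
  assumes "f \<in> carrier (poly_alg n)"
  shows "\<ominus>\<^bsub>poly_alg n\<^esub> f = - f"
proof -
  interpret cring "poly_alg n" by (rule poly_alg_cring)
  show ?thesis using assms by (intro minus_equality) auto
qed

lemma axis_ideal: "ideal (axis_ideal n k) (poly_alg n)"
proof (rule idealI)
  interpret cring "poly_alg n" by (rule poly_alg_cring)
  show "ring (poly_alg n)" by (rule ring_axioms)
  show "subgroup (axis_ideal n k) (add_monoid (poly_alg n))"
  proof
    fix f assume f: "f \<in> axis_ideal n k"
    then have c: "f \<in> carrier (poly_alg n)" by (simp add: axis_ideal_def)
    have "inv\<^bsub>add_monoid (poly_alg n)\<^esub> f = - f"
      using poly_alg_a_inv[OF c] by (simp add: a_inv_def)
    then show "inv\<^bsub>add_monoid (poly_alg n)\<^esub> f \<in> axis_ideal n k"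
      using f by (simp add: axis_ideal_def)
  qed (auto simp: axis_ideal_def lookup_add)
  fix a x assume "a \<in> axis_ideal n k" "x \<in> carrier (poly_alg n)"
  then show "x \<otimes>\<^bsub>poly_alg n\<^esub> a \<in> axis_ideal n k" "a \<otimes>\<^bsub>poly_alg n\<^esub> x \<in> axis_ideal n k"
    using axis_ideal_mult by (simp_all add: mult.commute)
qed

lemma axis_ideal_perm:
  assumes s: "\<sigma> permutes {1..n}" and f: "f \<in> axis_ideal n k"
  shows "perm_poly \<sigma> f \<in> axis_ideal n k"
  using f perm_poly_closed[OF s] permutes_in_image[OF permutes_inv[OF s]]
  unfolding axis_ideal_def
  by (simp add: lookup_perm_poly permutes_bij[OF s] map_key_single_inv del: atLeastAtMost_iff)

lemma conj_part_single: "j \<le> a \<Longrightarrow> conj_part [a] j = 1" "\<not> j \<le> a \<Longrightarrow> conj_part [a] j = 0"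
proof -
  have *: "{i. i < length [a] \<and> j \<le> [a] ! i} = (if j \<le> a then {0} else {})" by auto
  show "j \<le> a \<Longrightarrow> conj_part [a] j = 1" "\<not> j \<le> a \<Longrightarrow> conj_part [a] j = 0"
    unfolding conj_part_def * by auto
qed

lemma c_bound_single: "t \<le> a \<Longrightarrow> c_bound [a] t = 0"
  by (simp add: c_bound_def conj_part_single)

lemma c_bound_single_Suc: "c_bound [a] (Suc a) = - 1"
  by (simp add: c_bound_def conj_part_single)

text \<open>Every term is a squarefree monomial with two distinct variables, one of which differs
  from \<open>x_j\<close>, so \<open>lookup_Var_mult_axis\<close> makes its coefficient at
  \<open>x_j^d\<close> vanish.\<close>

lemma elem_sym_in_axis_ideal:
  assumes "X \<subseteq> {1..n}" "r \<ge> 2"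
  shows "elem_sym r X \<in> axis_ideal n k"
proof -
  have "Poly_Mapping.lookup (\<Prod>i\<in>A. Var i) (Poly_Mapping.single j d) = 0" if "card A = r" for A j d
  proof -
    \<comment> \<open>Infinite sets have cardinality 0, which \<open>r \<ge> 2\<close>
      excludes.\<close>
    from that assms(2) have "finite A" using card.infinite by fastforce
    from that assms(2) obtain i where i: "i \<in> A" by fastforce
    then have "card (A - {i}) \<ge> 1" using that assms(2) \<open>finite A\<close> by simp
    then have "A - {i} \<noteq> {}" by (metis card.empty not_one_le_zero)
    then obtain i' where i': "i' \<in> A - {i}" by blast
    have "(\<Prod>i\<in>A. Var i) = Var i * (Var i' * (\<Prod>i\<in>A - {i} - {i'}. Var i))"
      using i i' \<open>finite A\<close> by (metis finite_Diff prod.remove)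
    then show ?thesis using i' by (simp add: lookup_Var_mult_axis)
  qed
  moreover have "elem_sym r X \<in> carrier (poly_alg n)"
    unfolding elem_sym_def using assms(1) by (intro poly_alg_sum poly_alg_prod poly_alg_closed) auto
  ultimately show ?thesis unfolding axis_ideal_def by (simp add: elem_sym_def lookup_sum)
qed

lemma monomial_decomp:
  fixes f :: "'a \<Rightarrow>\<^sub>0 'b::comm_monoid_add"
  shows "f = (\<Sum>m\<in>Poly_Mapping.keys f. Poly_Mapping.single m (Poly_Mapping.lookup f m))"
  by (rule poly_mapping_eqI) (auto simp: lookup_sum lookup_single when_def in_keys_iff)

lemma ideal_sum:
  assumes I: "ideal I (poly_alg n)" and f: "\<And>a. a \<in> A \<Longrightarrow> f a \<in> I"
  shows "sum f A \<in> I"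
proof -
  interpret ideal I "poly_alg n" by (rule I)
  have "0 \<in> I" "\<And>x y. x \<in> I \<Longrightarrow> y \<in> I \<Longrightarrow> x + y \<in> I"
    using additive_subgroup.zero_closed[OF ideal.axioms(1)[OF I]]
      additive_subgroup.a_closed[OF ideal.axioms(1)[OF I]] by simp_all
  then show ?thesis using f by (induction A rule: infinite_finite_induct) simp_all
qed

text \<open>A monomial other than the \<open>x_j^d\<close> with \<open>d < k\<close> either involves
  two variables, and is a multiple of \<open>e_2\<close> of a pair, or is a power of one variable
  with exponent at least \<open>k\<close>. So \<open>axis_ideal\<close> is spanned by multiples of
  generators; conversely it contains the generators.\<close>

lemma griffin_ideal_eq:
  assumes n: "n \<ge> 2" and k: "k \<ge> 1"
  shows "griffin_ideal n k [n - 1] = axis_ideal n k"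
proof -
  let ?G = "{Var i ^ k | i. i \<in> {1..n}} \<union>
      {elem_sym r X | r X. X \<subseteq> {1..n} \<and> r \<le> card X \<and>
         c_bound [n - 1] (n - card X) + (int n - int (sum_list [n - 1])) < int r}"
  interpret cring "poly_alg n" by (rule poly_alg_cring)
  have "?G \<subseteq> axis_ideal n k"
  proof
    fix g assume "g \<in> ?G"
    then consider i where "g = Var i ^ k" "i \<in> {1..n}"
      | r X where "g = elem_sym r X" "X \<subseteq> {1..n}" "r \<le> card X"
          "c_bound [n - 1] (n - card X) + (int n - int (sum_list [n - 1])) < int r"
      by auto
    then show "g \<in> axis_ideal n k"
    proof cases
      case 1
      then show ?thesis
        by (auto simp: axis_ideal_def simp del: One_nat_def)
          (auto simp: Var_power lookup_single when_def single_eq_single_iff)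
    next
      case 2
      have "r \<ge> 2"
      \<comment> \<open>For empty \<open>X\<close> the index \<open>t = n\<close> exceeds the only
        part \<open>n - 1\<close>, so the bound drops to 0 and \<open>r \<le> card X\<close> is
        violated. For nonempty \<open>X\<close> the bound is 1.\<close>
      proof (cases "card X = 0")
        case True
        then show ?thesis using 2 c_bound_single_Suc[of "n - 1"] n by simp
      next
        case False
        then have "c_bound [n - 1] (n - card X) = 0" using n by (intro c_bound_single) auto
        then show ?thesis using 2 n by simp
      qed
      then show ?thesis using 2 elem_sym_in_axis_ideal by blast
    qed
  qed
  then have sub: "genideal (poly_alg n) ?G \<subseteq> axis_ideal n k"
    by (rule genideal_minimal[OF axis_ideal])
  have G: "?G \<subseteq> carrier (poly_alg n)"
    using \<open>?G \<subseteq> axis_ideal n k\<close> unfolding axis_ideal_def by blast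
  let ?I = "genideal (poly_alg n) ?G"
  have I: "ideal ?I (poly_alg n)" by (rule genideal_ideal[OF G])
  have GI: "?G \<subseteq> ?I" by (rule genideal_self[OF G])
  have Vk: "Var i ^ k \<in> ?I" if "i \<in> {1..n}" for i using that GI by blast
  have VV: "Var i * Var j \<in> ?I" if ij: "i \<in> {1..n}" "j \<in> {1..n}" "i \<noteq> j" for i j
  proof -
    have "A \<subseteq> {i, j} \<and> card A = 2 \<longleftrightarrow> A = {i, j}" for A
      using ij card_subset_eq[of "{i, j}" A] by auto
    then have eq: "elem_sym 2 {i, j} = Var i * Var j" using ij by (simp add: elem_sym_def)
    have "elem_sym 2 {i, j} \<in> ?G"
    proof -
      have "c_bound [n - 1] (n - card {i, j}) = 0" using n ij by (intro c_bound_single) auto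
      then have "c_bound [n - 1] (n - card {i, j}) + (int n - int (sum_list [n - 1])) < int 2"
        using n by simp
      moreover have "{i, j} \<subseteq> {1..n}" "2 \<le> card {i, j}" using ij by auto
      ultimately show ?thesis
        by (intro UnI2 CollectI exI[of _ 2] exI[of _ "{i, j}"] conjI refl)
    qed
    from subsetD[OF GI this] show ?thesis unfolding eq .
  qed
  have mono: "Poly_Mapping.single m c \<in> ?I"
    if m: "Poly_Mapping.keys m \<subseteq> {1..n}" and bad: "\<And>j d. j \<in> {1..n} \<Longrightarrow> d < k \<Longrightarrow> m \<noteq> Poly_Mapping.single j d"
    for m c
  proof (cases "\<exists>i\<in>Poly_Mapping.keys m. \<exists>j\<in>Poly_Mapping.keys m. i \<noteq> j")
    case True
    then obtain i j where ij: "i \<in> Poly_Mapping.keys m" "j \<in> Poly_Mapping.keys m" "i \<noteq> j" by auto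
    \<comment> \<open>Subtraction of exponents is truncated; it is exact here because
      \<open>i\<close> and \<open>j\<close> are distinct and both occur in \<open>m\<close>.\<close>
    define m' where "m' = m - Poly_Mapping.single i 1 - Poly_Mapping.single j 1"
    have m': "Poly_Mapping.keys m' \<subseteq> Poly_Mapping.keys m"
      by (auto simp: m'_def in_keys_iff lookup_minus)
    have "m = Poly_Mapping.single i 1 + Poly_Mapping.single j 1 + m'"
      using ij by (intro poly_mapping_eqI)
        (auto simp: m'_def lookup_add lookup_minus lookup_single when_def in_keys_iff)
    then have "Poly_Mapping.single m c = Var i * Var j * Poly_Mapping.single m' c"
      by (simp add: Var_def mult_single)
    moreover have "Poly_Mapping.single m' c \<in> carrier (poly_alg n)"
      using m m' by (auto simp: poly_alg_carrier)
    moreover have "Var i * Var j \<in> ?I" using VV ij m by blast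
    ultimately show ?thesis
      using ideal.I_r_closed[OF I, of "Var i * Var j"] by simp
  next
    case False
    obtain i where i: "i \<in> {1..n}" "Poly_Mapping.keys m \<subseteq> {i}"
    \<comment> \<open>The monomial 1 is treated as \<open>x_1^0\<close>.\<close>
    proof (cases "Poly_Mapping.keys m = {}")
      case True
      then show ?thesis using that[of 1] n by auto
    next
      case ne: False
      then obtain i where "i \<in> Poly_Mapping.keys m" by blast
      then show ?thesis using that[of i] m False by blast
    qed
    have mi: "m = Poly_Mapping.single i (Poly_Mapping.lookup m i)"
      using i(2) by (intro poly_mapping_eqI) (auto simp: lookup_single when_def in_keys_iff subset_iff)
    then have d: "Poly_Mapping.lookup m i \<ge> k" using bad[OF i(1)] by (metis not_le)
    then have "m = Poly_Mapping.single i k + Poly_Mapping.single i (Poly_Mapping.lookup m i - k)"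
      using mi by (simp flip: single_add)
    then have "Poly_Mapping.single m c =
        Var i ^ k * Poly_Mapping.single (Poly_Mapping.single i (Poly_Mapping.lookup m i - k)) c"
      by (simp add: Var_power mult_single)
    moreover have "Poly_Mapping.single (Poly_Mapping.single i (Poly_Mapping.lookup m i - k)) c \<in> carrier (poly_alg n)"
      using i by (auto simp: poly_alg_carrier)
    ultimately show ?thesis using ideal.I_r_closed[OF I Vk[OF i(1)]] by auto
  qed
  have "axis_ideal n k \<subseteq> ?I"
  proof
    fix f assume f: "f \<in> axis_ideal n k"
    have "Poly_Mapping.single m (Poly_Mapping.lookup f m) \<in> ?I" if "m \<in> Poly_Mapping.keys f" for m
    proof (rule mono)
      show "Poly_Mapping.keys m \<subseteq> {1..n}" using f that by (auto simp: axis_ideal_def poly_alg_carrier)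
      show "m \<noteq> Poly_Mapping.single j d" if "j \<in> {1..n}" "d < k" for j d
        using f that \<open>m \<in> Poly_Mapping.keys f\<close> by (auto simp: axis_ideal_def in_keys_iff)
    qed
    then have "(\<Sum>m\<in>Poly_Mapping.keys f. Poly_Mapping.single m (Poly_Mapping.lookup f m)) \<in> ?I"
      by (rule ideal_sum[OF I])
    then show "f \<in> ?I" using monomial_decomp[of f] by simp
  qed
  with sub show ?thesis unfolding griffin_ideal_def by blast
qed

section \<open>The quotient\<close>

locale stable_ideal =
  fixes n :: nat and I :: "mpoly set"
  assumes ideal: "ideal I (poly_alg n)"
    and stable: "\<sigma> permutes {1..n} \<Longrightarrow> f \<in> I \<Longrightarrow> perm_poly \<sigma> f \<in> I"
begin

abbreviation cls :: "mpoly \<Rightarrow> mpoly set" where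
  "cls f \<equiv> I +>\<^bsub>poly_alg n\<^esub> f"

lemma cls_eq_image: "cls f = (\<lambda>h. h + f) ` I"
  by (auto simp: a_r_coset_def')

lemma quot_carrier: "carrier (quot_alg n I) = cls ` carrier (poly_alg n)"
  by (auto simp: quot_alg_def FactRing_def A_RCOSETS_def' Let_def)

lemma cls_closed: "f \<in> carrier (poly_alg n) \<Longrightarrow> cls f \<in> carrier (quot_alg n I)"
  by (simp add: quot_carrier)

lemma quot_add:
  assumes "f \<in> carrier (poly_alg n)" "g \<in> carrier (poly_alg n)"
  shows "cls f \<oplus>\<^bsub>quot_alg n I\<^esub> cls g = cls (f + g)"
  using ideal.a_rcos_sum[OF ideal assms] by (simp add: quot_alg_def FactRing_def Let_def)

lemma quot_smult:
  assumes "f \<in> carrier (poly_alg n)"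
  shows "c \<odot>\<^bsub>quot_alg n I\<^esub> cls f = cls (Const c * f)"
  using ideal.rcoset_mult_add[OF ideal poly_alg_closed(3) assms]
  by (simp add: quot_alg_def FactRing_def Let_def)

lemma quot_zero: "\<zero>\<^bsub>quot_alg n I\<^esub> = cls 0"
  by (simp add: quot_alg_def FactRing_def Let_def cls_eq_image)

lemmas quot_simps = quot_add quot_smult quot_zero

lemma quot_vectorspace: "vectorspace class_ring (quot_alg n I)"
proof (rule vs_criteria)
  show "field (class_ring :: complex ring)" by (rule class_field.field_axioms)
  show "\<forall>v\<in>carrier (quot_alg n I). \<exists>neg_v\<in>carrier (quot_alg n I).
    v \<oplus>\<^bsub>quot_alg n I\<^esub> neg_v = \<zero>\<^bsub>quot_alg n I\<^esub>"
  proof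
    fix v assume "v \<in> carrier (quot_alg n I)"
    then obtain f where "f \<in> carrier (poly_alg n)" "v = cls f" by (auto simp: quot_carrier)
    then show "\<exists>neg_v\<in>carrier (quot_alg n I). v \<oplus>\<^bsub>quot_alg n I\<^esub> neg_v = \<zero>\<^bsub>quot_alg n I\<^esub>"
      by (intro bexI[of _ "cls (- f)"]) (simp_all add: quot_simps cls_closed)
  qed
qed (auto simp: quot_carrier quot_simps Const_simps algebra_simps)

text \<open>The image of a coset is a full coset only because \<sigma> maps \<open>I\<close> onto
  \<open>I\<close>; surjectivity comes from stability under the inverse permutation.\<close>

lemma perm_coset_cls:
  assumes s: "\<sigma> permutes {1..n}"
  shows "perm_coset \<sigma> (cls f) = cls (perm_poly \<sigma> f)"
proof -
  have b: "bij \<sigma>" "bij (inv' \<sigma>)" using s permutes_inv permutes_bij by blast+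
  have "perm_poly \<sigma> ` I = I"
  proof
    show "perm_poly \<sigma> ` I \<subseteq> I" using stable[OF s] by auto
    show "I \<subseteq> perm_poly \<sigma> ` I"
    proof
      fix h assume h: "h \<in> I"
      have "perm_poly \<sigma> (perm_poly (inv' \<sigma>) h) = h"
        using perm_poly_comp[OF b, of h] permutes_inv_o(1)[OF s] perm_poly_id by simp
      then show "h \<in> perm_poly \<sigma> ` I" using stable[OF permutes_inv[OF s] h] by (metis imageI)
    qed
  qed
  then have "(\<lambda>h. h + perm_poly \<sigma> f) ` I = (\<lambda>h. h + perm_poly \<sigma> f) ` perm_poly \<sigma> ` I" by simp
  then show ?thesis
    unfolding perm_coset_def cls_eq_image by (simp add: image_image perm_poly_add[OF b(1)])
qed

lemma quot_Sn_module: "Sn_module n (quot_alg n I) perm_coset"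
  unfolding Sn_module_def LinearCombinations.module_hom_def
  by (auto simp: quot_vectorspace sym_group_carrier quot_carrier quot_simps perm_coset_cls
      perm_poly_closed permutes_bij perm_poly_add perm_poly_Const_mult perm_poly_id perm_poly_comp
      permutes_compose)

lemma quot_minus:
  assumes "f \<in> carrier (poly_alg n)" "g \<in> carrier (poly_alg n)"
  shows "cls f \<ominus>\<^bsub>quot_alg n I\<^esub> cls g = cls (f - g)"
proof -
  interpret vectorspace class_ring "quot_alg n I" by (rule quot_vectorspace)
  have "cls f = cls (f - g) \<oplus>\<^bsub>quot_alg n I\<^esub> cls g" using assms by (simp add: quot_add)
  then show ?thesis
    using assms by (simp add: cls_closed M.minus_eq M.a_assoc M.r_neg)
qed

end

locale griffin_quotient =
  fixes n k :: nat
  assumes n: "n \<ge> 2" and k: "k \<ge> 1"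
begin

sublocale stable_ideal n "axis_ideal n k"
  by (rule stable_ideal.intro) (rule axis_ideal, rule axis_ideal_perm)

abbreviation V :: "(complex, mpoly set) module" where
  "V \<equiv> quot_alg n (axis_ideal n k)"

text \<open>Only meaningful for \<open>d < k\<close>, where the coefficient is constant on a coset. Note that
  \<open>coef j 0\<close> is the constant coefficient for every \<open>j\<close>.\<close>

definition coef :: "nat \<Rightarrow> nat \<Rightarrow> mpoly set \<Rightarrow> complex" where
  "coef j d X = Poly_Mapping.lookup (SOME f. f \<in> X) (Poly_Mapping.single j d)"

text \<open>The chosen representative differs from \<open>f\<close> by an element of
  \<open>axis_ideal\<close>, whose coefficient at \<open>x_j^d\<close> is 0.\<close>

lemma coef_cls:
  assumes "j \<in> {1..n}" "d < k"
  shows "coef j d (cls f) = Poly_Mapping.lookup f (Poly_Mapping.single j d)"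
proof -
  have "f \<in> cls f"
    using additive_subgroup.zero_closed[OF ideal.axioms(1)[OF axis_ideal]] by (force simp: cls_eq_image)
  then have "(SOME f'. f' \<in> cls f) \<in> cls f" by (rule someI)
  then obtain h where "h \<in> axis_ideal n k" "(SOME f'. f' \<in> cls f) = h + f"
    by (auto simp: cls_eq_image)
  then show ?thesis using assms unfolding coef_def axis_ideal_def by (simp add: lookup_add)
qed

lemma coef_functional:
  assumes "j \<in> {1..n}" "d < k"
  shows "functional V (coef j d)"
  unfolding functional_def
  by (auto simp: quot_carrier quot_simps coef_cls[OF assms] lookup_add lookup_Const_mult)

lemma coef_separates:
  assumes x: "x \<in> carrier V" and c: "\<And>j d. j \<in> {1..n} \<Longrightarrow> d < k \<Longrightarrow> coef j d x = 0"
  shows "x = \<zero>\<^bsub>V\<^esub>"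
proof -
  obtain f where f: "f \<in> carrier (poly_alg n)" "x = cls f" using x by (auto simp: quot_carrier)
  have "Poly_Mapping.lookup f (Poly_Mapping.single j d) = 0" if "j \<in> {1..n}" "d < k" for j d
    using c[OF that] unfolding f(2) coef_cls[OF that] .
  then have "f \<in> axis_ideal n k" using f(1) by (simp add: axis_ideal_def)
  interpret cring "poly_alg n" by (rule poly_alg_cring)
  have "cls f = axis_ideal n k" by (rule a_rcos_zero[OF axis_ideal \<open>f \<in> axis_ideal n k\<close>])
  moreover have "cls 0 = axis_ideal n k" by (simp add: cls_eq_image)
  ultimately show ?thesis using f by (simp add: quot_zero)
qed

text \<open>Reduces identities in the quotient to comparing coefficients at powers of single
  variables.\<close>

lemma cls_eqI:
  assumes "f \<in> carrier (poly_alg n)" "g \<in> carrier (poly_alg n)"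
    and "\<And>j d. j \<in> {1..n} \<Longrightarrow> d < k \<Longrightarrow>
      Poly_Mapping.lookup f (Poly_Mapping.single j d) = Poly_Mapping.lookup g (Poly_Mapping.single j d)"
  shows "cls f = cls g"
proof -
  have "f - g \<in> axis_ideal n k" using assms by (simp add: axis_ideal_def lookup_minus)
  interpret cring "poly_alg n" by (rule poly_alg_cring)
  have "cls (f - g) = \<zero>\<^bsub>V\<^esub>"
    using a_rcos_zero[OF axis_ideal \<open>f - g \<in> axis_ideal n k\<close>] by (simp add: quot_zero cls_eq_image)
  then have "cls (f - g) \<oplus>\<^bsub>V\<^esub> cls g = cls 0 \<oplus>\<^bsub>V\<^esub> cls g" by (simp add: quot_zero)
  then show ?thesis using assms by (simp add: quot_add)
qed

end

section \<open>The claimed basis and its coefficients at powers of single variables\<close>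

lemma elem_sym_1: "finite X \<Longrightarrow> elem_sym 1 X = (\<Sum>i\<in>X. Var i)"
proof -
  assume "finite X"
  have "{A. A \<subseteq> X \<and> card A = 1} = (\<lambda>i. {i}) ` X"
    by (auto simp: card_1_singleton_iff)
  then show ?thesis unfolding elem_sym_def by (simp add: sum.reindex)
qed

text \<open>On the axis of \<open>x_j\<close> only the summand \<open>x_j\<close> of
  \<open>e_1\<close> acts, and it shifts the degree by one. For \<open>i > 0\<close> this says that
  \<open>e_1^i\<close> is congruent to the power sum of degree \<open>i\<close>.\<close>

lemma lookup_e1_power:
  assumes "j \<in> {1..n}"
  shows "Poly_Mapping.lookup (elem_sym 1 {1..n} ^ i) (Poly_Mapping.single j d) = of_bool (d = i)"
proof (induction i arbitrary: d)
  case 0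
  have "Poly_Mapping.single j d = 0 \<longleftrightarrow> d = 0"
    using single_eq_single_iff[of j d j 0] by simp
  then show ?case by (simp add: lookup_one when_def)
next
  case (Suc i)
  show ?case
    \<comment> \<open>For \<open>d = 0\<close> the rule \<open>single_zero\<close> would collapse
      the exponent of \<open>x_j^0\<close> to 0 and hide it from
      \<open>lookup_Var_mult_axis\<close>.\<close>
    using assms Suc unfolding elem_sym_1[OF finite_atLeastAtMost]
    by (cases d) (simp_all add: sum_distrib_right lookup_sum lookup_Var_mult_axis del: single_zero)
qed

text \<open>The difference of variables contributes one degree, whence \<open>Suc i\<close>; this is
  the shift by \<open>des S\<close> in the range of exponents.\<close>

lemma lookup_diff_mult_e1_power:
  assumes "j \<in> {1..n}"
  shows "Poly_Mapping.lookup ((Var b - Var a) * elem_sym 1 {1..n} ^ i) (Poly_Mapping.single j d) =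
    of_bool (d = Suc i) * (of_bool (j = b) - of_bool (j = a))"
  using lookup_e1_power[OF assms]
  by (auto simp: left_diff_distrib lookup_minus lookup_Var_mult_axis)

lemma lookup_Var_power:
  "Poly_Mapping.lookup (Var i ^ r) (Poly_Mapping.single j d) = of_bool (d = r \<and> (r = 0 \<or> i = j))"
  by (auto simp: Var_power lookup_single single_eq_single_iff)

lemma lookup_of_nat_mult:
  fixes f :: mpoly
  shows "Poly_Mapping.lookup (of_nat a * f) m = of_nat a * Poly_Mapping.lookup f m"
  using lookup_Const_mult[of "of_nat a"] by (simp add: Const_of_nat)

lemma lookup_fact_mult:
  fixes f :: mpoly
  shows "Poly_Mapping.lookup (fact a * f) m = fact a * Poly_Mapping.lookup f m"
  using lookup_of_nat_mult[of "fact a" f m] by simp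

lemma poly_alg_elem_sym_1 [simp]: "elem_sym (Suc 0) {Suc 0..n} \<in> carrier (poly_alg n)"
  unfolding One_nat_def[symmetric] elem_sym_1[OF finite_atLeastAtMost]
  by (rule poly_alg_sum) (rule poly_alg_closed)

lemma poly_alg_fact [simp]: "fact a \<in> carrier (poly_alg n)"
  using poly_alg_of_nat[of "fact a" n] by simp

text \<open>Here \<open>d\<close> is the total degree, and \<open>b\<close> is the entry in the
  upper row of a standard filling of the hook. That entry is at least 2, which frees
  \<open>b = 1\<close> to stand for the one-row tableau. Hook polynomials have degree at least 1, so
  they start at \<open>d = 1\<close>.\<close>

definition basis_index :: "nat \<Rightarrow> nat \<Rightarrow> (nat \<times> nat) set" where
  "basis_index n k = {(d, b). d < k \<and> b \<in> {1..n} \<and> (b = 1 \<or> d > 0)}"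

text \<open>For \<open>b \<noteq> 1\<close> the factor \<open>Var b - Var 1\<close> supplies one
  degree, leaving \<open>d - 1\<close>; the subtraction is exact on \<open>basis_index\<close>,
  where such \<open>b\<close> come with \<open>d > 0\<close>.\<close>

definition basis_poly :: "nat \<Rightarrow> nat \<times> nat \<Rightarrow> mpoly" where
  "basis_poly n = (\<lambda>(d, b). if b = 1 then of_nat (fact n) * elem_sym 1 {1..n} ^ d
     else of_nat (fact (n - 1)) * ((Var b - Var 1) * elem_sym 1 {1..n} ^ (d - 1)))"

lemma basis_poly_closed:
  "(d, b) \<in> basis_index n k \<Longrightarrow> basis_poly n (d, b) \<in> carrier (poly_alg n)"
  unfolding basis_index_def basis_poly_def by (cases "1 \<le> n") auto

lemma lookup_basis_poly:
  assumes "(d, b) \<in> basis_index n k" "j \<in> {1..n}"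
  shows "Poly_Mapping.lookup (basis_poly n (d, b)) (Poly_Mapping.single j d') =
    of_bool (d' = d) * (if b = 1 then fact n else fact (n - 1) * (of_bool (j = b) - of_bool (j = 1)))"
  using assms unfolding basis_poly_def basis_index_def
  by (auto simp: lookup_fact_mult lookup_e1_power lookup_diff_mult_e1_power
      simp del: One_nat_def)

section \<open>Dual functionals and blocks of the quotient\<close>

context griffin_quotient
begin

definition mean :: "nat \<Rightarrow> mpoly set \<Rightarrow> complex" where
  "mean d X = (\<Sum>j\<in>{1..n}. coef j d X) / of_nat n"

text \<open>Subtracting the mean kills the power sums, and the mean kills the differences. Only the
  deviations at \<open>b \<noteq> 1\<close> are kept, since all \<open>n\<close> deviations add up
  to zero. The factorials undo the constants in \<open>basis_poly\<close>.\<close>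

definition dual_coef :: "nat \<times> nat \<Rightarrow> mpoly set \<Rightarrow> complex" where
  "dual_coef = (\<lambda>(d, b) X. if b = 1 then mean d X / fact n else (coef b d X - mean d X) / fact (n - 1))"

definition basis_vec :: "nat \<times> nat \<Rightarrow> mpoly set" where
  "basis_vec p = cls (basis_poly n p)"

lemma mean_functional:
  assumes "d < k"
  shows "functional V (mean d)"
  using coef_functional[OF _ assms] unfolding functional_def mean_def
  by (auto simp: sum.distrib add_divide_distrib sum_distrib_left[symmetric])

lemma dual_coef_functional:
  assumes "p \<in> basis_index n k"
  shows "functional V (dual_coef p)"
proof -
  obtain d b where p: "p = (d, b)" "d < k" "b \<in> {1..n}"
    using assms by (cases p) (auto simp: basis_index_def)
  show ?thesis
    using mean_functional[OF p(2)] coef_functional[OF p(3,2)]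
    unfolding functional_def dual_coef_def p(1)
    by (auto simp: add_divide_distrib diff_divide_distrib algebra_simps)
qed

lemma coef_basis_vec:
  assumes "(d, b) \<in> basis_index n k" "j \<in> {1..n}" "d' < k"
  shows "coef j d' (basis_vec (d, b)) =
    of_bool (d' = d) * (if b = 1 then fact n else fact (n - 1) * (of_bool (j = b) - of_bool (j = 1)))"
  unfolding basis_vec_def coef_cls[OF assms(2,3)] by (rule lookup_basis_poly[OF assms(1,2)])

lemma mean_basis_vec:
  assumes db: "(d, b) \<in> basis_index n k" and d': "d' < k"
  shows "mean d' (basis_vec (d, b)) = of_bool (d' = d) * (if b = 1 then fact n else 0)"
proof -
  have b: "b \<in> {1..n}" using db by (simp add: basis_index_def)
  have s: "(\<Sum>j\<in>{1..n}. of_bool (j = b) - of_bool (j = 1)) = (0::complex)"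
    using n b by (simp add: sum_subtractf of_bool_def)
  have "mean d' (basis_vec (d, b)) = of_bool (d' = d) *
    (\<Sum>j\<in>{1..n}. if b = 1 then fact n else fact (n - 1) * (of_bool (j = b) - of_bool (j = 1))) / of_nat n"
    unfolding mean_def sum_distrib_left using coef_basis_vec[OF db _ d']
    by (intro arg_cong2[where f="(/)"] sum.cong refl) blast
  also have "\<dots> = of_bool (d' = d) * (if b = 1 then fact n else 0)"
    using n s by (cases "b = 1") (simp_all add: sum_distrib_left[symmetric] del: One_nat_def)
  finally show ?thesis .
qed

text \<open>Separation is the point at issue: if the mean and the deviations at
  \<open>b \<ge> 2\<close> vanish, so do the coefficients at \<open>b \<ge> 2\<close>, and then the
  vanishing sum takes care of the coefficient at \<open>x_1^d\<close>.\<close>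

lemma dual_basis: "dual_basis V (basis_index n k) basis_vec dual_coef"
proof (rule dual_basis.intro)
  show "vectorspace class_ring V" by (rule quot_vectorspace)
  show "finite (basis_index n k)"
    by (rule finite_subset[of _ "{..<k} \<times> {1..n}"]) (auto simp: basis_index_def)
  show "basis_vec p \<in> carrier V" if "p \<in> basis_index n k" for p
    using that basis_poly_closed by (cases p) (auto simp: basis_vec_def cls_closed)
  show "functional V (dual_coef p)" if "p \<in> basis_index n k" for p
    by (rule dual_coef_functional[OF that])
  show "dual_coef p (basis_vec q) = (if p = q then 1 else 0)"
    if pq: "p \<in> basis_index n k" "q \<in> basis_index n k" for p q
  proof -
    obtain d b d' b' where eq: "p = (d', b')" "q = (d, b)" by (metis surj_pair)
    have *: "d' < k" "b' \<in> {1..n}" using pq eq by (auto simp: basis_index_def)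
    show ?thesis
      unfolding eq dual_coef_def prod.case
        mean_basis_vec[OF pq(2)[unfolded eq] *(1)] coef_basis_vec[OF pq(2)[unfolded eq] *(2,1)]
      by auto
  qed
  show "x = \<zero>\<^bsub>V\<^esub>"
    if x: "x \<in> carrier V" and z: "\<And>p. p \<in> basis_index n k \<Longrightarrow> dual_coef p x = 0" for x
  proof (rule coef_separates[OF x])
    fix j d assume j: "j \<in> {1..n}" and d: "d < k"
    have "(d, 1) \<in> basis_index n k" using n d by (simp add: basis_index_def)
    from z[OF this] have m: "mean d x = 0" by (simp add: dual_coef_def)
    show "coef j d x = 0"
    proof (cases "d = 0")
      case True
      \<comment> \<open>In degree 0 every \<open>coef i 0\<close> is the constant coefficient, so
        the mean alone determines it.\<close>
      have "(\<Sum>i\<in>{1..n}. coef i d x) = (\<Sum>i\<in>{1..n}. coef j d x)"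
        unfolding coef_def True by simp
      then have "(\<Sum>i\<in>{1..n}. coef i d x) = of_nat n * coef j d x" by simp
      then show ?thesis using m n by (simp add: mean_def)
    next
      case False
      have c: "coef b d x = 0" if "b \<in> {1..n} - {1}" for b
      proof -
        have "(d, b) \<in> basis_index n k" using that d False by (simp add: basis_index_def)
        from z[OF this] show ?thesis using that m by (simp add: dual_coef_def)
      qed
      have "(\<Sum>i\<in>{1..n}. coef i d x) = coef 1 d x + (\<Sum>i\<in>{1..n} - {1}. coef i d x)"
        using n by (intro sum.remove) auto
      moreover have "(\<Sum>i\<in>{1..n}. coef i d x) = 0" using m n by (simp add: mean_def)
      moreover have "(\<Sum>i\<in>{1..n} - {1}. coef i d x) = 0" using c by (rule sum.neutral[OF ballI])
      ultimately have "coef 1 d x = 0" by simp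
      then show ?thesis using c j by (cases "j = 1") auto
    qed
  qed
qed

text \<open>One copy of \<open>V_(n)\<close> in each degree below \<open>k\<close>, and one of
  \<open>V_(n-1,1)\<close> in each positive degree below \<open>k\<close>; the sizes add up to
  \<open>n * (k - 1) + 1\<close>.\<close>

definition blocks :: "(nat \<times> nat) set set" where
  "blocks = (\<lambda>d. {(d, 1)}) ` {..<k} \<union> (\<lambda>d. {d} \<times> {2..n}) ` {1..<k}"

lemma partition_blocks: "partition_on (basis_index n k) blocks"
proof (rule partition_onI)
  show "\<Union>blocks = basis_index n k"
    using n by (auto simp: blocks_def basis_index_def)
  have "K \<noteq> {}" if "K \<in> blocks" for K using that n unfolding blocks_def
    by (elim UnE imageE; hypsubst) simp_all
  then show "{} \<notin> blocks" by blast
  show "disjnt p q" if "p \<in> blocks" "q \<in> blocks" "p \<noteq> q" for p q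
    using that by (auto simp: blocks_def disjnt_def)
qed

lemma perm_cls_eqI:
  assumes s: "\<sigma> permutes {1..n}" and f: "f \<in> carrier (poly_alg n)" and g: "g \<in> carrier (poly_alg n)"
    and eq: "\<And>j d. j \<in> {1..n} \<Longrightarrow> d < k \<Longrightarrow> Poly_Mapping.lookup f (Poly_Mapping.single (inv' \<sigma> j) d) =
      Poly_Mapping.lookup g (Poly_Mapping.single j d)"
  shows "perm_coset \<sigma> (cls f) = cls g"
  unfolding perm_coset_cls[OF s]
  by (rule cls_eqI[OF perm_poly_closed[OF s f] g])
    (simp add: lookup_perm_poly permutes_bij[OF s] map_key_single_inv eq del: atLeastAtMost_iff)

lemma invariant_vector_quot:
  assumes d: "d < k"
  shows "invariant_vector n V perm_coset (basis_vec (d, 1)) (dual_coef (d, 1))"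
proof
  have i: "(d, 1) \<in> basis_index n k" using n d by (simp add: basis_index_def)
  interpret dual_basis V "basis_index n k" basis_vec dual_coef by (rule dual_basis)
  show "Sn_module n V perm_coset" by (rule quot_Sn_module)
  show "basis_vec (d, 1) \<in> carrier V" by (rule closed[OF i])
  show "functional V (dual_coef (d, 1))" by (rule func[OF i])
  show "dual_coef (d, 1) (basis_vec (d, 1)) = 1" using dual[OF i i] by simp
  fix \<sigma> assume s: "\<sigma> permutes {1..n}"
  show "perm_coset \<sigma> (basis_vec (d, 1)) = basis_vec (d, 1)"
    unfolding basis_vec_def
  proof (rule perm_cls_eqI[OF s basis_poly_closed[OF i] basis_poly_closed[OF i]])
    fix j d' assume j: "j \<in> {1..n}"
    then have "inv' \<sigma> j \<in> {1..n}" using permutes_in_image[OF permutes_inv[OF s]] by blast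
    \<comment> \<open>For \<open>b = 1\<close> the coefficient in degree \<open>d\<close> is
      \<open>n!\<close> on every axis, so permuting the axes changes nothing.\<close>
    from lookup_basis_poly[OF i this] lookup_basis_poly[OF i j]
    show "Poly_Mapping.lookup (basis_poly n (d, 1)) (Poly_Mapping.single (inv' \<sigma> j) d') =
      Poly_Mapping.lookup (basis_poly n (d, 1)) (Poly_Mapping.single j d')" by simp
  qed
qed

lemma permuted_family_quot:
  assumes d: "0 < d" "d < k"
  shows "permuted_family n V perm_coset (\<lambda>j. cls (Var j ^ d)) (\<lambda>j. coef j d)"
proof
  show "n \<ge> 2" by (rule n)
  show "Sn_module n V perm_coset" by (rule quot_Sn_module)
  show "cls (Var j ^ d) \<in> carrier V" if "j \<in> {1..n}" for j
    using that by (intro cls_closed poly_alg_power poly_alg_closed)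
  show "functional V (coef j d)" if "j \<in> {1..n}" for j by (rule coef_functional[OF that d(2)])
  show "coef i d (cls (Var j ^ d)) = (if i = j then 1 else 0)" if "i \<in> {1..n}" "j \<in> {1..n}" for i j
    unfolding coef_cls[OF that(1) d(2)] lookup_Var_power using d by auto
  show "perm_coset \<sigma> (cls (Var j ^ d)) = cls (Var (\<sigma> j) ^ d)"
    if s: "\<sigma> permutes {1..n}" and j: "j \<in> {1..n}" for \<sigma> j
  proof (rule perm_cls_eqI[OF s])
    show "Var j ^ d \<in> carrier (poly_alg n)" "Var (\<sigma> j) ^ d \<in> carrier (poly_alg n)"
      using j permutes_in_image[OF s] by (blast intro: poly_alg_power poly_alg_closed)+
    show "Poly_Mapping.lookup (Var j ^ d) (Poly_Mapping.single (inv' \<sigma> i) d') =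
        Poly_Mapping.lookup (Var (\<sigma> j) ^ d) (Poly_Mapping.single i d')" for i d'
      unfolding lookup_Var_power using permutes_inv_eq[OF s, of i j] by auto
  qed
qed

text \<open>Modulo the ideal the basis vector at \<open>(d, b)\<close> is \<open>(n - 1)!\<close>
  times \<open>x_b^d - x_1^d\<close>, and by \<open>span_eq_std\<close> such differences already
  span the sum-zero combinations.\<close>

lemma span_std_block:
  assumes d: "0 < d" "d < k"
  shows "LinearCombinations.module.span class_ring V (basis_vec ` ({d} \<times> {2..n})) =
    permuted_family.std n V (\<lambda>j. cls (Var j ^ d))"
proof -
  interpret permuted_family n V perm_coset "\<lambda>j. cls (Var j ^ d)" "\<lambda>j. coef j d"
    by (rule permuted_family_quot[OF d])
  have Vc: "Var j ^ d \<in> carrier (poly_alg n)" if "j \<in> {1..n}" for j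
    using that by (intro poly_alg_power poly_alg_closed)
  have one: "1 \<in> {1..n}" using n by simp
  have eq: "cls (Var b ^ d) \<ominus>\<^bsub>V\<^esub> cls (Var 1 ^ d) = (1 / fact (n - 1)) \<odot>\<^bsub>V\<^esub> basis_vec (d, b)"
    if b: "b \<in> {2..n}" for b
  proof -
    have b': "b \<in> {1..n}" "b \<noteq> 1" using b by auto
    have i: "(d, b) \<in> basis_index n k" using b' d by (simp add: basis_index_def)
    have "cls (Var b ^ d - Var 1 ^ d) = cls (Const (1 / fact (n - 1)) * basis_poly n (d, b))"
    proof (rule cls_eqI)
      fix j d' assume j: "j \<in> {1..n}"
      show "Poly_Mapping.lookup (Var b ^ d - Var 1 ^ d) (Poly_Mapping.single j d') =
         Poly_Mapping.lookup (Const (1 / fact (n - 1)) * basis_poly n (d, b)) (Poly_Mapping.single j d')"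
        unfolding lookup_Const_mult lookup_minus lookup_Var_power lookup_basis_poly[OF i j]
        using d b' by auto
    qed (use Vc[OF b'(1)] Vc[OF one] basis_poly_closed[OF i] in simp_all)
    then show ?thesis
      unfolding basis_vec_def quot_minus[OF Vc[OF b'(1)] Vc[OF one]] quot_smult[OF basis_poly_closed[OF i]] .
  qed
  have A: "basis_vec ` ({d} \<times> {2..n}) \<subseteq> carrier V"
    using dual_basis.closed[OF dual_basis] d by (force simp: basis_index_def)
  show ?thesis
  proof (rule span_eq_std)
    show "basis_vec ` ({d} \<times> {2..n}) \<subseteq> std"
    proof clarify
      fix b assume b: "b \<in> {2..n}"
      then have b': "b \<in> {1..n}" by auto
      have "basis_vec (d, b) \<in> carrier V" using A b by auto
      then have "basis_vec (d, b) = fact (n - 1) \<odot>\<^bsub>V\<^esub> ((1 / fact (n - 1)) \<odot>\<^bsub>V\<^esub> basis_vec (d, b))"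
        using smult_assoc1[of "fact (n - 1)" "1 / fact (n - 1)" "basis_vec (d, b)"]
          vectorspace_smult_simps(1)[OF vectorspace_axioms] by simp
      also have "\<dots> = fact (n - 1) \<odot>\<^bsub>V\<^esub> comb (unit_diff b 1)"
        unfolding eq[OF b, symmetric] comb_unit_diff[OF b' one] ..
      also have "\<dots> \<in> std"
        using unit_diff_sum[OF b' one] submodule.smult_closed[OF std_submodule] unfolding std_def by auto
      finally show "basis_vec (d, b) \<in> std" .
    qed
    show "cls (Var b ^ d) \<ominus>\<^bsub>V\<^esub> cls (Var 1 ^ d) \<in> span (basis_vec ` ({d} \<times> {2..n}))" if b: "b \<in> {2..n}" for b
      unfolding eq[OF b]
    proof (rule submodule.smult_closed[OF span_is_submodule[OF A]])
      show "basis_vec (d, b) \<in> span (basis_vec ` ({d} \<times> {2..n}))" using in_own_span[OF A] b by blast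
    qed simp
  qed
qed

end

section \<open>Tableaux of content \<open>(n - 1, 1)\<close>\<close>

definition row_S :: "nat \<Rightarrow> tableau" where
  "row_S n = [replicate (n - 1) 1 @ [2]]"

definition hook_S :: "nat \<Rightarrow> tableau" where
  "hook_S n = [replicate (n - 1) 1, [2]]"

lemma count_list_replicate_if: "count_list (replicate m x) y = (if x = y then m else 0)"
  by (induction m) auto

lemma cells_row: "cells [r] = {0} \<times> {..<length r}"
  by (auto simp: cells_def)

lemma cells_hook: "cells [r, [b]] = insert (1, 0) ({0} \<times> {..<length r})"
  by (auto simp: cells_def less_Suc_eq nth_Cons split: nat.splits)

lemma semistandard_row: "r \<noteq> [] \<Longrightarrow> sorted r \<Longrightarrow> semistandard [r]"
  unfolding semistandard_def cells_row by (auto simp: is_partition_def shape_def)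

lemma semistandard_hook:
  assumes "r \<noteq> []" "sorted r" "r ! 0 < b"
  shows "semistandard [r, [b]]"
proof -
  have "0 < length r" using assms by simp
  then have "is_partition (shape [r, [b]])"
    unfolding is_partition_def shape_def by (auto simp: Suc_le_eq)
  then show ?thesis
    using assms unfolding semistandard_def cells_hook by (auto simp: entry_def)
qed

text \<open>With one row, sortedness and content determine the row. With two rows, every upper entry
  lies above an entry that is at least 1, hence is 2; there is only one 2, so it fills the upper row
  and the lower row consists of ones.\<close>

lemma content_tableau_cases:
  assumes n: "n \<ge> 2" and S: "semistandard S" "has_content S [n - 1, 1]"
  shows "S = row_S n \<or> S = hook_S n"
proof -
  have cnt: "count_list (concat S) i = (if i = 1 then n - 1 else if i = 2 then 1 else 0)" for i
  proof -
    have "count_list (concat S) i = (if 1 \<le> i \<and> i \<le> 2 then [n - 1, 1] ! (i - 1) else 0)"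
      using S(2) by (simp add: has_content_def)
    also have "\<dots> = (if i = 1 then n - 1 else if i = 2 then 1 else 0)"
    proof -
      consider "i = 0" | "i = 1" | "i = 2" | "i > 2" by linarith
      then show ?thesis by cases auto
    qed
    finally show ?thesis .
  qed
  have mem: "x = 1 \<or> x = 2" if "x \<in> set (concat S)" for x
    using cnt[of x] that count_list_0_iff[of "concat S" x] by (auto split: if_splits)
  have cell: "entry S (r, c) \<in> set (concat S)" if "(r, c) \<in> cells S" for r c
    using that unfolding cells_def entry_def by (auto intro!: bexI[of _ "S ! r"])
  have len: "length (S ! r) \<ge> length (S ! r')" if "r < r'" "r' < length S" for r r'
    using S(1) that unfolding semistandard_def is_partition_def shape_def
    by (auto simp: sorted_wrt_map sorted_wrt_iff_nth_less)
  have ne: "row \<noteq> []" if "row \<in> set S" for row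
    using S(1) that unfolding semistandard_def is_partition_def shape_def by force
  have col: "entry S (r, c) < entry S (Suc r, c)" if "(Suc r, c) \<in> cells S" for r c
    using S(1) that unfolding semistandard_def by blast
  have srt: "sorted row" if "row \<in> set S" for row
    using S(1) that unfolding semistandard_def by blast
  have below: "(r, c) \<in> cells S" if "(Suc r, c) \<in> cells S" for r c
    using that len[of r "Suc r"] unfolding cells_def by auto
  have "length S \<noteq> 0"
  proof
    assume "length S = 0"
    then show False using cnt[of 2] by simp
  qed
  moreover have "\<not> 2 < length S"
  proof
    assume "2 < length S"
    then have "S ! 2 \<in> set S" by simp
    then have "(Suc (Suc 0), 0) \<in> cells S"
      using \<open>2 < length S\<close> ne unfolding cells_def by (auto simp: numeral_2_eq_2)
    \<comment> \<open>A third row would force three strictly increasing values in the first column,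
      but only 1 and 2 occur.\<close>
    then have "entry S (0, 0) < entry S (Suc 0, 0)" "entry S (Suc 0, 0) < entry S (Suc (Suc 0), 0)"
      "entry S (0, 0) \<in> set (concat S)" "entry S (Suc (Suc 0), 0) \<in> set (concat S)"
      using col below cell by blast+
    then show False using mem[of "entry S (0, 0)"] mem[of "entry S (Suc (Suc 0), 0)"] by linarith
  qed
  ultimately consider "length S = 1" | "length S = 2" by linarith
  then show ?thesis
  proof cases
    case 1
    then obtain r where r: "S = [r]" by (auto simp: length_Suc_conv)
    have "mset r = mset (replicate (n - 1) 1 @ [2])"
    proof (rule multiset_eqI)
      fix x
      show "count (mset r) x = count (mset (replicate (n - 1) 1 @ [2])) x"
        using cnt[of x] by (simp add: r count_mset[symmetric] split: if_splits)
    qed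
    moreover have "sorted r" using srt r by simp
    moreover have "sorted (replicate (n - 1) 1 @ [2::nat])" by (simp add: sorted_append)
    ultimately have "r = replicate (n - 1) 1 @ [2]" by (metis properties_for_sort)
    then show ?thesis by (simp add: r row_S_def)
  next
    case 2
    then obtain r q where rq: "S = [r, q]" by (auto simp: length_Suc_conv numeral_2_eq_2)
    have "x = 2" if x: "x \<in> set q" for x
    proof -
      obtain c where c: "c < length q" "x = q ! c" using x by (metis in_set_conv_nth)
      then have cc: "(Suc 0, c) \<in> cells S" by (simp add: cells_def rq)
      have "entry S (0, c) < x" using col[OF cc] c by (simp add: entry_def rq)
      moreover have "entry S (0, c) \<ge> 1" using mem[OF cell[OF below[OF cc]]] by auto
      moreover have "x = 1 \<or> x = 2" using mem x by (simp add: rq)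
      ultimately show ?thesis by linarith
    qed
    then have q: "q = replicate (length q) 2" by (simp add: replicate_eqI)
    have "count_list r 2 + length q = 1"
    proof -
      have "count_list q 2 = length q" by (subst q) (simp add: count_list_replicate_if)
      then show ?thesis using cnt[of 2] by (simp add: rq)
    qed
    moreover have "length q > 0" using ne rq by simp
    ultimately have "length q = 1" "count_list r 2 = 0" by linarith+
    have q2: "q = [2]" using q \<open>length q = 1\<close> by simp
    have "x = 1" if "x \<in> set r" for x
      using mem[of x] that \<open>count_list r 2 = 0\<close> by (auto simp: rq count_list_0_iff)
    then have r: "r = replicate (length r) 1" by (simp add: replicate_eqI)
    have "count_list r 1 = n - 1" using cnt[of 1] by (simp add: rq q2)
    moreover have "count_list r 1 = length r" by (subst r) (simp add: count_list_replicate_if)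
    ultimately show ?thesis using r by (simp add: rq q2 hook_S_def)
  qed
qed

lemma row_S_tableau:
  assumes "n \<ge> 2"
  shows "semistandard (row_S n)" "has_content (row_S n) [n - 1, 1]" "shape (row_S n) = [n]"
proof -
  show "semistandard (row_S n)"
    unfolding row_S_def by (rule semistandard_row) (auto simp: sorted_append)
  show "shape (row_S n) = [n]" using assms by (simp add: shape_def row_S_def)
  show "has_content (row_S n) [n - 1, 1]"
    unfolding has_content_def
  proof
    fix i :: nat
    consider "i = 0" | "i = 1" | "i = 2" | "i > 2" by linarith
    then show "count_list (concat (row_S n)) i =
        (if 1 \<le> i \<and> i \<le> length [n - 1, 1] then [n - 1, 1] ! (i - 1) else 0)"
      by cases (simp_all add: row_S_def count_list_replicate_if)
  qed
qed

lemma hook_S_tableau: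
  assumes "n \<ge> 2"
  shows "semistandard (hook_S n)" "has_content (hook_S n) [n - 1, 1]" "shape (hook_S n) = [n - 1, 1]"
proof -
  show "semistandard (hook_S n)"
    unfolding hook_S_def using assms by (intro semistandard_hook) auto
  show "shape (hook_S n) = [n - 1, 1]" using assms by (simp add: shape_def hook_S_def)
  show "has_content (hook_S n) [n - 1, 1]"
    unfolding has_content_def
  proof
    fix i :: nat
    consider "i = 0" | "i = 1" | "i = 2" | "i > 2" by linarith
    then show "count_list (concat (hook_S n)) i =
        (if 1 \<le> i \<and> i \<le> length [n - 1, 1] then [n - 1, 1] ! (i - 1) else 0)"
      by cases (simp_all add: hook_S_def count_list_replicate_if)
  qed
qed

lemma des_row: "des [r] = 0"
  unfolding des_def cells_row by auto

lemma des_hook_S: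
  assumes "n \<ge> 2"
  shows "des (hook_S n) = 1"
proof -
  have "{i. \<exists>s\<in>cells (hook_S n). \<exists>s'\<in>cells (hook_S n).
      entry (hook_S n) s = i \<and> entry (hook_S n) s' = Suc i \<and> fst s < fst s'} = {1}"
  proof
    show "{1} \<subseteq> {i. \<exists>s\<in>cells (hook_S n). \<exists>s'\<in>cells (hook_S n).
      entry (hook_S n) s = i \<and> entry (hook_S n) s' = Suc i \<and> fst s < fst s'}"
    proof -
      have "(0, 0) \<in> cells (hook_S n)" "(1, 0) \<in> cells (hook_S n)"
        "entry (hook_S n) (0, 0) = 1" "entry (hook_S n) (1, 0) = Suc 1"
        using assms unfolding hook_S_def cells_hook by (auto simp: entry_def)
      then show ?thesis by force
    qed
  qed (auto simp: hook_S_def cells_hook entry_def)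
  then show ?thesis by (simp add: des_def)
qed

subsection \<open>Cocharge labels\<close>

text \<open>A label counts certain \<open>b\<close> with \<open>1 \<le> b < w ! q\<close>, and there
  are none, whichever subword the position belongs to.\<close>

lemma cocharge_label_one: "w ! q = 1 \<Longrightarrow> cocharge_label w q = 0"
  unfolding cocharge_label_def Let_def by (simp add: card_eq_0_iff)

lemma next_pos_left:
  assumes "finite P" "q \<in> P" "w ! q = a" "q < p"
    and "\<And>q'. q' \<in> P \<Longrightarrow> w ! q' = a \<Longrightarrow> q' < p \<Longrightarrow> q' \<le> q"
  shows "next_pos w P a p = Some q"
proof -
  have "Max {q' \<in> {q' \<in> P. w ! q' = a}. q' < p} = q"
    by (rule Max_eqI) (use assms in auto)
  moreover have "q \<in> {q' \<in> {q' \<in> P. w ! q' = a}. q' < p}" using assms by simp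
  ultimately show ?thesis unfolding next_pos_def Let_def by auto
qed

lemma next_pos_wrap:
  assumes "finite P" "q \<in> P" "w ! q = a"
    and "\<And>q'. q' \<in> P \<Longrightarrow> w ! q' = a \<Longrightarrow> p \<le> q' \<and> q' \<le> q"
  shows "next_pos w P a p = Some q"
proof -
  have "Max {q' \<in> P. w ! q' = a} = q"
    by (rule Max_eqI) (use assms in auto)
  moreover have "{q' \<in> {q' \<in> P. w ! q' = a}. q' < p} = {}" using assms(4) by fastforce
  moreover have "q \<in> {q' \<in> P. w ! q' = a}" using assms by simp
  ultimately show ?thesis unfolding next_pos_def Let_def by auto
qed

lemma sub_pos_one: "sub_pos w P 1 = next_pos w P 1 (length w)"
  by simp

lemma sub_pos_two: "sub_pos w P 1 = Some p \<Longrightarrow> sub_pos w P 2 = next_pos w P 2 p"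
  by (simp add: numeral_2_eq_2)

text \<open>The letter 2 at \<open>q\<close> is extracted with the first standard subword, so the
  relevant set is \<open>remaining w 0\<close>, that is, all positions, and only
  \<open>b = 1\<close> can be counted.\<close>

lemma cocharge_label_two:
  assumes q: "w ! q = 2" and p1: "sub_pos w {..<length w} 1 = Some p"
    and p2: "sub_pos w {..<length w} 2 = Some q"
  shows "cocharge_label w q = of_bool (q < p)"
proof -
  have "q \<notin> remaining w (Suc 0)" using p2 by (auto intro: exI[of _ 2])
  then have L: "(LEAST j. q \<notin> remaining w (Suc j)) = 0" by (rule Least_eq_0)
  have "{b. 1 \<le> b \<and> b < w ! q \<and> the (sub_pos w (remaining w 0) (Suc b)) < the (sub_pos w (remaining w 0) b)}
    = (if q < p then {1} else {})"
    using q p1 p2 by (auto simp: numeral_2_eq_2 less_Suc_eq simp del: sub_pos.simps)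
  then show ?thesis unfolding cocharge_label_def L Let_def by simp
qed

text \<open>The reading word is \<open>1 ... 1 2\<close>. No 2 lies to the left of the last 1, at
  position \<open>n - 2\<close>, so the search wraps around to position \<open>n - 1\<close>; the 2
  is right of its 1 and gets label 0.\<close>

lemma cw_row_S:
  assumes n: "n \<ge> 2" and s: "s \<in> cells (row_S n)"
  shows "cw (row_S n) s = 0"
proof -
  let ?w = "replicate (n - 1) 1 @ [2::nat]"
  obtain c where c: "s = (0, c)" "c < n" using s n by (auto simp: row_S_def cells_row)
  have cw: "cw (row_S n) s = cocharge_label ?w c"
    by (simp add: cw_def reading_word_def reading_pos_def row_S_def c)
  show ?thesis
  proof (cases "c < n - 1")
    case True
    then have "?w ! c = 1" by (simp add: nth_append)
    then show ?thesis unfolding cw by (rule cocharge_label_one)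
  next
    case False
    then have c: "c = n - 1" using c by simp
    have len: "length ?w = n" using n by simp
    have w: "?w ! i = (if i = n - 1 then 2 else 1)" if "i < n" for i
      using that by (auto simp: nth_append)
    have p1: "sub_pos ?w {..<length ?w} 1 = Some (n - 2)"
      unfolding sub_pos_one len
    proof (rule next_pos_left)
      show "q \<le> n - 2" if "q \<in> {..<n}" "?w ! q = 1" for q
      proof -
        from that(1) have q: "q < n" by simp
        have "(if q = n - 1 then 2 else 1) = (1::nat)" using that(2) unfolding w[OF q] .
        then have "q \<noteq> n - 1" by (cases "q = n - 1") simp_all
        with q show ?thesis by simp
      qed
    qed (use n w[of "n - 2"] in auto)
    have p2: "sub_pos ?w {..<length ?w} 2 = Some (n - 1)"
      unfolding sub_pos_two[OF p1] unfolding len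
    proof (rule next_pos_wrap)
      show "n - 2 \<le> q \<and> q \<le> n - 1" if "q \<in> {..<n}" "?w ! q = 2" for q
      proof -
        from that(1) have q: "q < n" by simp
        have "(if q = n - 1 then 2 else 1) = (2::nat)" using that(2) unfolding w[OF q] .
        then have "q = n - 1" by (cases "q = n - 1") simp_all
        then show ?thesis by simp
      qed
    qed (use n w[of "n - 1"] in auto)
    have "?w ! (n - 1) = 2" using w[of "n - 1"] n by simp
    from cocharge_label_two[OF this p1 p2] show ?thesis unfolding cw c by simp
  qed
qed

text \<open>The reading word is \<open>2 1 ... 1\<close>, so the 2 at position 0 lies left of the
  last 1, at position \<open>n - 1\<close>, and gets label 1.\<close>

lemma cw_hook_S:
  assumes n: "n \<ge> 2"
  shows "c < n - 1 \<Longrightarrow> cw (hook_S n) (0, c) = 0" "cw (hook_S n) (1, 0) = 1"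
proof -
  let ?w = "2 # replicate (n - 1) (1::nat)"
  have len: "length ?w = n" using n by simp
  have w: "?w ! i = (if i = 0 then 2 else 1)" if "i < n" for i
    using that by (cases i) auto
  show "cw (hook_S n) (0, c) = 0" if "c < n - 1"
  proof -
    have "cw (hook_S n) (0, c) = cocharge_label ?w (Suc c)"
      by (simp add: cw_def reading_word_def reading_pos_def hook_S_def)
    then show ?thesis using cocharge_label_one[of ?w "Suc c"] that by simp
  qed
  have p1: "sub_pos ?w {..<length ?w} 1 = Some (n - 1)"
    unfolding sub_pos_one len by (rule next_pos_left) (use n w[of "n - 1"] in auto)
  have p2: "sub_pos ?w {..<length ?w} 2 = Some 0"
    unfolding sub_pos_two[OF p1] unfolding len
  proof (rule next_pos_left)
    show "q \<le> 0" if "q \<in> {..<n}" "?w ! q = 2" for q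
    proof -
      from that(1) have q: "q < n" by simp
      have "(if q = 0 then 2 else 1) = (2::nat)" using that(2) unfolding w[OF q] .
      then show ?thesis by (cases "q = 0") simp_all
    qed
  qed (use n in auto)
  have "cw (hook_S n) (1, 0) = cocharge_label ?w 0"
    by (simp add: cw_def reading_word_def reading_pos_def hook_S_def)
  then show "cw (hook_S n) (1, 0) = 1" using cocharge_label_two[OF _ p1 p2] n by simp
qed

subsection \<open>Young symmetrizers\<close>

text \<open>All columns have one box, so the column stabilizer is trivial, while the row stabilizer
  is the full symmetric group. Each of its \<open>n!\<close> elements fixes the polynomial
  1.\<close>

lemma young_sym_row:
  assumes T: "bij_filling n [r]"
  shows "young_sym n [r] 1 = fact n"
proof -
  have r: "set r = {1..n}" using T by (simp add: bij_filling_def)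
  have "col_stab n [r] = {id}"
  proof
    show "col_stab n [r] \<subseteq> {id}"
    proof
      fix \<tau> assume t: "\<tau> \<in> col_stab n [r]"
      then have p: "\<tau> permutes {1..n}" by (simp add: col_stab_def sym_group_carrier)
      have "\<tau> x = x" if "x \<in> {1..n}" for x
      proof -
        have "x \<in> set r" using that r by blast
        then obtain c where c: "c < length r" "x = r ! c" by (metis in_set_conv_nth)
        then have "{entry [r] s |s. s \<in> cells [r] \<and> snd s = c} = {x}"
          by (auto simp: cells_row entry_def)
        moreover have "\<tau> ` {entry [r] s |s. s \<in> cells [r] \<and> snd s = c} =
            {entry [r] s |s. s \<in> cells [r] \<and> snd s = c}"
          using t unfolding col_stab_def by (simp only: mem_Collect_eq)
        ultimately show ?thesis by simp
      qed
      then show "\<tau> \<in> {id}" using p by (auto simp: fun_eq_iff permutes_def)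
    qed
    show "{id} \<subseteq> col_stab n [r]" by (auto simp: col_stab_def sym_group_carrier permutes_id)
  qed
  moreover have "row_stab n [r] = {\<sigma>. \<sigma> permutes {1..n}}"
  proof -
    have "{entry [r] s |s. s \<in> cells [r] \<and> fst s = i} = (if i = 0 then {1..n} else {})" for i
      unfolding r[symmetric] by (auto simp: cells_row entry_def set_conv_nth)
    note rows = this
    have "\<sigma> \<in> row_stab n [r] \<longleftrightarrow> \<sigma> permutes {1..n}" for \<sigma>
      using permutes_image[of \<sigma> "{1..n}"] unfolding row_stab_def rows
      by (auto simp: sym_group_carrier)
    then show ?thesis by blast
  qed
  ultimately have "young_sym n [r] 1 = (\<Sum>\<sigma> | \<sigma> permutes {1..n}. perm_poly \<sigma> 1)"
    by (simp add: young_sym_def)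
  also have "\<dots> = (\<Sum>\<sigma> | \<sigma> permutes {1..n}. 1)"
    by (intro sum.cong refl perm_poly_1) (auto intro: permutes_bij)
  also have "\<dots> = fact n" by (simp add: card_permutations)
  finally show ?thesis .
qed

text \<open>Row permutations fix \<open>b\<close>, so all \<open>(n - 1)!\<close> of them contribute
  equally. The only column of height 2 consists of \<open>r ! 0\<close> and \<open>b\<close>; their
  transposition has sign -1 and exchanges the two variables.\<close>

lemma young_sym_hook:
  assumes T: "bij_filling n [r, [b]]" and r0: "r \<noteq> []"
  shows "young_sym n [r, [b]] (Var b) = fact (n - 1) * (Var b - Var (r ! 0))"
proof -
  let ?T = "[r, [b]]"
  define a where "a = r ! 0"
  have rb: "distinct r" "b \<notin> set r" "set r \<union> {b} = {1..n}"
    using T by (auto simp: bij_filling_def)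
  then have sr: "set r = {1..n} - {b}" and b: "b \<in> {1..n}" by auto
  have a: "a \<in> set r" "a \<noteq> b" using r0 rb unfolding a_def by (auto simp: length_greater_0_conv)
  have rows: "{entry ?T s |s. s \<in> cells ?T \<and> fst s = i} = (if i = 0 then set r else if i = 1 then {b} else {})" for i
    unfolding cells_hook by (auto simp: entry_def set_conv_nth)
  have cols: "{entry ?T s |s. s \<in> cells ?T \<and> snd s = c} =
      (if c = 0 then {a, b} else if c < length r then {r ! c} else {})" for c
  proof -
    have "{entry ?T s |s. s \<in> cells ?T \<and> snd s = c} = entry ?T ` {s \<in> cells ?T. snd s = c}" by blast
    also have "{s \<in> cells ?T. snd s = c} =
        (if c = 0 then {(0, 0), (1, 0)} else if c < length r then {(0, c)} else {})"
      unfolding cells_hook using r0 by auto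
    finally show ?thesis by (simp add: a_def entry_def)
  qed
  have row: "row_stab n ?T = {\<sigma>. \<sigma> permutes set r}"
  proof (intro equalityI subsetI CollectI)
    fix \<sigma> assume s: "\<sigma> \<in> row_stab n ?T"
    then have p: "\<sigma> permutes {1..n}" and im: "\<sigma> ` {b} = {b}"
      using rows[of 1] unfolding row_stab_def sym_group_carrier by (auto dest: spec[of _ 1])
    then show "\<sigma> permutes set r" unfolding sr by (intro permutes_superset[OF p]) auto
  next
    fix \<sigma> assume "\<sigma> \<in> {\<sigma>. \<sigma> permutes set r}"
    then have p: "\<sigma> permutes set r" by simp
    then have "\<sigma> permutes {1..n}" using sr by (auto intro: permutes_subset)
    moreover have "\<sigma> b = b" using p rb(2) by (auto simp: permutes_def)
    ultimately show "\<sigma> \<in> row_stab n ?T"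
      using permutes_image[OF p] unfolding row_stab_def rows sym_group_carrier by simp
  qed
  have col: "col_stab n ?T = {id, transpose a b}"
  proof (intro equalityI subsetI)
    fix \<tau> assume t: "\<tau> \<in> col_stab n ?T"
    then have p: "\<tau> permutes {1..n}"
      and im: "\<And>c. \<tau> ` (if c = 0 then {a, b} else if c < length r then {r ! c} else {}) =
         (if c = 0 then {a, b} else if c < length r then {r ! c} else {})"
      unfolding col_stab_def cols sym_group_carrier by blast+
    \<comment> \<open>Entries outside the first column are alone in their columns and therefore
      fixed.\<close>
    have "\<tau> permutes {a, b}"
    proof (rule permutes_superset[OF p])
      fix x assume "x \<in> {1..n} - {a, b}"
      then have "x \<in> set r" "x \<noteq> a" using sr by auto
      then obtain c where "c < length r" "x = r ! c" "c \<noteq> 0" by (metis in_set_conv_nth a_def)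
      then show "\<tau> x = x" using im[of c] by simp
    qed
    then show "\<tau> \<in> {id, transpose a b}" using permutes_doubleton_iff[of \<tau> a b] by blast
  next
    fix \<tau> assume t: "\<tau> \<in> {id, transpose a b}"
    have "transpose a b permutes {1..n}" using a b sr by (intro permutes_swap_id) auto
    moreover have "transpose a b (r ! c) = r ! c" if "0 < c" "c < length r" for c
    proof -
      have "r ! c \<noteq> a" unfolding a_def using that rb(1) r0 by (simp add: nth_eq_iff_index_eq)
      moreover have "r ! c \<noteq> b" using that rb(2) by auto
      ultimately show ?thesis by (simp add: transpose_def)
    qed
    ultimately show "\<tau> \<in> col_stab n ?T"
      using t unfolding col_stab_def cols sym_group_carrier by (auto simp: permutes_id transpose_def)
  qed
  have summand: "(\<Sum>\<sigma>\<in>row_stab n ?T. c * perm_poly (\<tau> \<circ> \<sigma>) (Var b)) = c * (fact (n - 1) * Var (\<tau> b))"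
    if t: "bij \<tau>" for \<tau> c
  proof -
    have "(\<Sum>\<sigma>\<in>row_stab n ?T. c * perm_poly (\<tau> \<circ> \<sigma>) (Var b)) = (\<Sum>\<sigma> | \<sigma> permutes set r. c * Var (\<tau> b))"
      unfolding row
    proof (intro sum.cong refl)
      fix \<sigma> assume "\<sigma> \<in> {\<sigma>. \<sigma> permutes set r}"
      then have p: "\<sigma> permutes set r" by simp
      have "\<sigma> b = b" using p rb(2) by (auto simp: permutes_def)
      then show "c * perm_poly (\<tau> \<circ> \<sigma>) (Var b) = c * Var (\<tau> b)"
        using perm_poly_Var[OF bij_comp[OF permutes_bij[OF p] t]] by simp
    qed
    also have "\<dots> = of_nat (card {\<sigma>. \<sigma> permutes set r}) * (c * Var (\<tau> b))" by simp
    also have "card {\<sigma>. \<sigma> permutes set r} = fact (n - 1)"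
      using b by (intro card_permutations) (auto simp: sr)
    finally show ?thesis by (simp only: of_nat_fact mult_ac)
  qed
  have "id \<noteq> transpose a b" using a(2) by (metis id_apply transpose_apply_first)
  have "young_sym n ?T (Var b) = (\<Sum>\<tau>\<in>{id, transpose a b}. of_int (sign \<tau>) * (fact (n - 1) * Var (\<tau> b)))"
    unfolding young_sym_def col by (intro sum.cong refl summand) auto
  also have "\<dots> = fact (n - 1) * Var b + - (fact (n - 1) * Var a)"
    using \<open>id \<noteq> transpose a b\<close> a(2) by (simp add: sign_swap_id)
  finally show ?thesis unfolding a_def by (simp add: right_diff_distrib)
qed

lemma higher_specht_row_S:
  assumes n: "n \<ge> 2" and T: "bij_filling n [r]" "length r = n"
  shows "higher_specht n (row_S n) [r] = fact n"
proof -
  have "cw_monomial (row_S n) [r] = 1"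
    unfolding cw_monomial_def using cw_row_S[OF n] by (intro prod.neutral) simp
  then show ?thesis unfolding higher_specht_def by (simp add: young_sym_row[OF T(1)])
qed

lemma higher_specht_hook_S:
  assumes n: "n \<ge> 2" and T: "bij_filling n [r, [b]]" "length r = n - 1"
  shows "higher_specht n (hook_S n) [r, [b]] = fact (n - 1) * (Var b - Var (r ! 0))"
proof -
  have c: "cells (hook_S n) = insert (1, 0) ({0} \<times> {..<n - 1})"
    unfolding hook_S_def cells_hook by simp
  have "(\<Prod>s\<in>{0} \<times> {..<n - 1}. Var (entry [r, [b]] s) ^ cw (hook_S n) s) = 1"
    using cw_hook_S(1)[OF n] by (intro prod.neutral) auto
  then have "cw_monomial (hook_S n) [r, [b]] = Var b"
    unfolding cw_monomial_def c by (simp add: cw_hook_S(2)[OF n, unfolded One_nat_def] entry_def)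
  moreover have "r \<noteq> []" using T(2) n by auto
  ultimately show ?thesis unfolding higher_specht_def by (simp add: young_sym_hook[OF T(1)])
qed

lemma shape_row: "shape T = [m] \<Longrightarrow> \<exists>r. T = [r] \<and> length r = m"
  unfolding shape_def by (cases T) auto

lemma shape_hook: "shape T = [m, 1] \<Longrightarrow> \<exists>r b. T = [r, [b]] \<and> length r = m"
  unfolding shape_def by (auto simp: map_eq_Cons_conv length_Suc_conv)

lemma standard_row_exists: "n \<ge> 1 \<Longrightarrow> standard n [[1..<Suc n]]"
  unfolding standard_def bij_filling_def by (auto intro!: semistandard_row simp del: upt_Suc)

text \<open>For \<open>b\<close> in \<open>{2..n}\<close>, the lower row of the only standard
  filling of shape \<open>(n - 1, 1)\<close> with \<open>b\<close> on top.\<close>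

definition hook_row :: "nat \<Rightarrow> nat \<Rightarrow> nat list" where
  "hook_row n b = filter (\<lambda>x. x \<noteq> b) [1..<Suc n]"

lemma hook_row:
  assumes b: "b \<in> {2..n}"
  shows "bij_filling n [hook_row n b, [b]]" "length (hook_row n b) = n - 1" "hook_row n b ! 0 = 1"
    "sorted (hook_row n b)"
proof -
  show f: "bij_filling n [hook_row n b, [b]]"
    using b unfolding bij_filling_def hook_row_def by (auto simp del: upt_Suc)
  have "length (hook_row n b) = card (set (hook_row n b))"
    using f by (intro distinct_card[symmetric]) (simp add: bij_filling_def)
  also have "set (hook_row n b) = {1..n} - {b}" unfolding hook_row_def by auto
  finally show "length (hook_row n b) = n - 1" using b by simp
  have "[1..<Suc n] = 1 # [2..<Suc n]" using b by (simp add: upt_conv_Cons numeral_2_eq_2 del: upt_Suc)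
  then show "hook_row n b ! 0 = 1" using b unfolding hook_row_def by (simp del: upt_Suc)
  show "sorted (hook_row n b)" unfolding hook_row_def by (intro sorted_wrt_filter sorted_upt)
qed

text \<open>The entry 1 sits in the corner: it cannot be \<open>b\<close>, which exceeds
  \<open>r ! 0\<close>, and within the sorted row it comes first.\<close>

lemma standard_hook:
  assumes n: "n \<ge> 2" and T: "standard n [r, [b]]" "length r = n - 1"
  shows "r ! 0 = 1" "b \<in> {2..n}"
proof -
  have rb: "b \<notin> set r" "set r \<union> {b} = {1..n}"
    using T by (auto simp: standard_def bij_filling_def)
  have r0: "0 < length r" using T(2) n by simp
  have "(Suc 0, 0) \<in> cells [r, [b]]" by (simp add: cells_def)
  then have lt: "r ! 0 < b"
    using T(1) unfolding standard_def semistandard_def by (force simp: entry_def)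
  have "sorted r" using T(1) unfolding standard_def semistandard_def by simp
  have "r ! 0 \<in> {1..n}" using r0 rb nth_mem by blast
  then have "r ! 0 \<ge> 1" by simp
  have "1 \<in> set r"
  proof -
    have "1 \<in> set r \<union> {b}" unfolding rb using n by simp
    then show ?thesis using lt \<open>r ! 0 \<ge> 1\<close> by auto
  qed
  then obtain c where "c < length r" "r ! c = 1" by (metis in_set_conv_nth)
  then have "r ! 0 \<le> 1" using \<open>sorted r\<close> by (metis sorted_nth_mono le0)
  then show "r ! 0 = 1" using \<open>r ! 0 \<ge> 1\<close> by simp
  have "b \<in> {1..n}" using rb by blast
  then show "b \<in> {2..n}" using lt \<open>r ! 0 \<ge> 1\<close> by auto
qed

text \<open>A product has index \<open>(i, 1)\<close> for the one-row tableau and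
  \<open>(i + 1, b)\<close> for the hook with \<open>b\<close> on top. The first component is
  \<open>i + des S\<close> in both cases, so the condition on \<open>i\<close> becomes
  \<open>d < k\<close>.\<close>

lemma B_set_eq:
  assumes n: "n \<ge> 2"
  shows "B_set n k = basis_poly n ` basis_index n k"
proof
  show "B_set n k \<subseteq> basis_poly n ` basis_index n k"
  proof
    fix f assume "f \<in> B_set n k"
    then obtain S T i where S: "semistandard S" "has_content S [n - 1, 1]"
      and T: "standard n T" "shape T = shape S" and i: "i < k - des S"
      and f: "f = higher_specht n S T * elem_sym 1 {1..n} ^ i"
      unfolding B_set_def by blast
    from content_tableau_cases[OF n S] show "f \<in> basis_poly n ` basis_index n k"
    proof
      assume S: "S = row_S n"
      then obtain r where r: "T = [r]" "length r = n"
        using shape_row[of T n] T(2) row_S_tableau(3)[OF n] by auto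
      have "f = basis_poly n (i, 1)"
        using higher_specht_row_S[OF n _ r(2)] T(1) r(1) by (simp add: f S basis_poly_def standard_def)
      moreover have "(i, 1) \<in> basis_index n k" using i n by (simp add: basis_index_def S row_S_def des_row)
      ultimately show ?thesis by blast
    next
      assume S: "S = hook_S n"
      then obtain r b where r: "T = [r, [b]]" "length r = n - 1"
        using shape_hook[of T "n - 1"] T(2) hook_S_tableau(3)[OF n] by auto
      have b: "r ! 0 = 1" "b \<in> {2..n}" using standard_hook[OF n _ r(2)] T(1) r(1) by auto
      have "f = basis_poly n (Suc i, b)"
        using higher_specht_hook_S[OF n _ r(2)] T(1) r(1) b
        by (simp add: f S basis_poly_def standard_def mult.assoc)
      moreover have "(Suc i, b) \<in> basis_index n k" using i n b by (auto simp: basis_index_def S des_hook_S)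
      ultimately show ?thesis by blast
    qed
  qed
  show "basis_poly n ` basis_index n k \<subseteq> B_set n k"
  proof (clarify)
    fix d b assume db: "(d, b) \<in> basis_index n k"
    show "basis_poly n (d, b) \<in> B_set n k"
    proof (cases "b = 1")
      case True
      have T: "standard n [[1..<Suc n]]" using n by (intro standard_row_exists) simp
      have "basis_poly n (d, b) = higher_specht n (row_S n) [[1..<Suc n]] * elem_sym 1 {1..n} ^ d"
        using True T by (subst higher_specht_row_S[OF n]) (simp_all add: basis_poly_def standard_def)
      moreover have "d < k - des (row_S n)" using db by (simp add: basis_index_def row_S_def des_row)
      moreover have "shape [[1..<Suc n]] = shape (row_S n)"
        using row_S_tableau(3)[OF n] by (simp add: shape_def)
      ultimately show ?thesis using T row_S_tableau(1,2)[OF n] unfolding B_set_def by blast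
    next
      case False
      with db have b: "b \<in> {2..n}" and d: "0 < d" "d < k" by (auto simp: basis_index_def)
      let ?T = "[hook_row n b, [b]]"
      have "hook_row n b \<noteq> []" using hook_row(2)[OF b] n by auto
      then have T: "standard n ?T"
        unfolding standard_def using hook_row[OF b] b by (auto intro!: semistandard_hook)
      have "basis_poly n (d, b) = higher_specht n (hook_S n) ?T * elem_sym 1 {1..n} ^ (d - 1)"
        using False hook_row(3)[OF b] by (subst higher_specht_hook_S[OF n hook_row(1,2)[OF b]])
          (simp add: basis_poly_def mult.assoc)
      moreover have "d - 1 < k - des (hook_S n)" using d by (simp add: des_hook_S[OF n])
      moreover have "shape ?T = shape (hook_S n)"
        using hook_S_tableau(3)[OF n] hook_row(2)[OF b] by (simp add: shape_def)
      ultimately show ?thesis using T hook_S_tableau(1,2)[OF n] unfolding B_set_def by blast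
    qed
  qed
qed

section \<open>The Specht modules of shapes \<open>(n)\<close> and \<open>(n - 1, 1)\<close>\<close>

lemma specht_poly_row: "specht_poly [r] = 1"
proof -
  have "{(i, j, c). i < j \<and> (j, c) \<in> cells [r]} = {}" by (auto simp: cells_row)
  then show ?thesis unfolding specht_poly_def by (simp only: prod.empty)
qed

lemma specht_poly_hook: "specht_poly [r, [b]] = Var b - Var (r ! 0)"
proof -
  have "{(i, j, c). i < j \<and> (j, c) \<in> cells [r, [b]]} = {(0, 1, 0)}" by (auto simp: cells_hook)
  then show ?thesis unfolding specht_poly_def by (simp add: entry_def)
qed

lemma poly_alg_lookup_functional: "functional (poly_alg n) (\<lambda>f. Poly_Mapping.lookup f m)"
  unfolding functional_def by (simp add: lookup_add lookup_Const_mult)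

text \<open>The constants are the model for shape \<open>(n)\<close>: a one-row filling has no pair
  of boxes in a column, so its Specht polynomial is the empty product.\<close>

lemma invariant_vector_poly_alg:
  "invariant_vector n (poly_alg n) perm_poly 1 (\<lambda>f. Poly_Mapping.lookup f 0)"
proof
  show "Sn_module n (poly_alg n) perm_poly" by (rule poly_alg_Sn_module)
qed (simp_all add: poly_alg_lookup_functional perm_poly_1 permutes_bij)

lemma specht_module_row:
  assumes "n \<ge> 1"
  shows "specht_module n [n] = (poly_alg n)\<lparr>carrier := invariant_vector.line (poly_alg n) 1\<rparr>"
proof -
  interpret invariant_vector n "poly_alg n" perm_poly 1 "\<lambda>f. Poly_Mapping.lookup f 0"
    by (rule invariant_vector_poly_alg)
  have "{specht_poly T |T. shape T = [n] \<and> bij_filling n T} = {1}"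
  proof
    show "{specht_poly T |T. shape T = [n] \<and> bij_filling n T} \<subseteq> {1}"
      using shape_row specht_poly_row by fastforce
    have "shape [[1..<Suc n]] = [n]" by (simp add: shape_def del: upt_Suc)
    moreover have "bij_filling n [[1..<Suc n]]"
      using standard_row_exists[OF assms] by (simp add: standard_def)
    ultimately show "{1} \<subseteq> {specht_poly T |T. shape T = [n] \<and> bij_filling n T}"
      using specht_poly_row by (metis (mono_tags, lifting) mem_Collect_eq singletonD subsetI)
  qed
  then show ?thesis unfolding specht_module_def using line_span by simp
qed

lemma permuted_family_poly_alg:
  assumes "n \<ge> 2"
  shows "permuted_family n (poly_alg n) perm_poly Var
    (\<lambda>j f. Poly_Mapping.lookup f (Poly_Mapping.single j 1))"
proof
  show "Sn_module n (poly_alg n) perm_poly" by (rule poly_alg_Sn_module)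
  show "Poly_Mapping.lookup (Var j) (Poly_Mapping.single i 1) = (if i = j then 1 else 0)" for i j
    unfolding Var_def lookup_single single_eq_single_iff by auto
qed (use assms in \<open>simp_all add: poly_alg_lookup_functional perm_poly_Var permutes_bij\<close>)

text \<open>A filling with \<open>a\<close> in the corner and \<open>b\<close> on top gives
  \<open>x_b - x_a\<close>, a sum-zero combination of the variables; the fillings built from
  \<open>hook_row\<close>, where \<open>a = 1\<close>, already span.\<close>

lemma specht_module_hook:
  assumes n: "n \<ge> 2"
  shows "specht_module n [n - 1, 1] = (poly_alg n)\<lparr>carrier := permuted_family.std n (poly_alg n) Var\<rparr>"
proof -
  interpret permuted_family n "poly_alg n" perm_poly Var
    "\<lambda>j f. Poly_Mapping.lookup f (Poly_Mapping.single j 1)"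
    by (rule permuted_family_poly_alg[OF n])
  let ?A = "{specht_poly T |T. shape T = [n - 1, 1] \<and> bij_filling n T}"
  have minus: "x \<ominus>\<^bsub>poly_alg n\<^esub> y = x - y" if "y \<in> carrier (poly_alg n)" for x y
    by (simp add: a_minus_def poly_alg_a_inv[OF that])
  have sub: "?A \<subseteq> std"
  proof
    fix f assume "f \<in> ?A"
    then obtain T where T: "shape T = [n - 1, 1]" "bij_filling n T" "f = specht_poly T" by auto
    from shape_hook[OF T(1)] obtain r b where r: "T = [r, [b]]" "length r = n - 1" by auto
    have "set r \<union> {b} = {1..n}" using T(2) by (auto simp: bij_filling_def r)
    moreover have "r ! 0 \<in> set r" using r n by (intro nth_mem) simp
    ultimately have i: "b \<in> {1..n}" "r ! 0 \<in> {1..n}" by blast+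
    have "f = comb (unit_diff b (r ! 0))"
      unfolding comb_unit_diff[OF i] using T(3) r minus[OF y_closed[OF i(2)]] by (simp add: specht_poly_hook)
    then show "f \<in> std" using unit_diff_sum[OF i] unfolding std_def by blast
  qed
  have "span ?A = std"
  proof (rule span_eq_std[OF sub])
    fix b assume b: "b \<in> {2..n}"
    have "shape [hook_row n b, [b]] = [n - 1, 1]" using hook_row(2)[OF b] by (simp add: shape_def)
    moreover have "specht_poly [hook_row n b, [b]] = Var b - Var 1"
      using hook_row(3)[OF b] by (simp add: specht_poly_hook)
    ultimately have "Var b - Var 1 \<in> ?A" using hook_row(1)[OF b] by (metis (mono_tags, lifting) mem_Collect_eq)
    moreover have "?A \<subseteq> carrier (poly_alg n)" using sub submodule.subset[OF std_submodule] by blast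
    ultimately have "Var b - Var 1 \<in> span ?A" using in_own_span by blast
    then show "Var b \<ominus>\<^bsub>poly_alg n\<^esub> Var 1 \<in> span ?A"
      using n by (simp add: minus)
  qed
  then show ?thesis unfolding specht_module_def by simp
qed

section \<open>Decomposition of the quotient into irreducibles\<close>

context griffin_quotient
begin

abbreviation span_V :: "mpoly set set \<Rightarrow> mpoly set set" where
  "span_V \<equiv> LinearCombinations.module.span class_ring V"

text \<open>The span of a block is recognised as the line or the sum-zero space of the quotient,
  which is then compared with the corresponding space in the polynomial ring.\<close>

lemma block_components:
  assumes K: "K \<in> blocks"
  shows "Sn_submodule n V perm_coset (span_V (basis_vec ` K)) \<and>
    Sn_irreducible n (V\<lparr>carrier := span_V (basis_vec ` K)\<rparr>) perm_coset \<and>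
    (\<exists>\<nu>. is_partition \<nu> \<and> sum_list \<nu> = n \<and>
      Sn_isomorphic n (V\<lparr>carrier := span_V (basis_vec ` K)\<rparr>) perm_coset (specht_module n \<nu>) perm_poly)"
proof -
  from K consider d where "K = {(d, 1)}" "d < k" | d where "K = {d} \<times> {2..n}" "0 < d" "d < k"
    unfolding blocks_def by fastforce
  then show ?thesis
  proof cases
    case 1
    interpret A: invariant_vector n V perm_coset "basis_vec (d, 1)" "dual_coef (d, 1)"
      by (rule invariant_vector_quot[OF 1(2)])
    have s: "span_V (basis_vec ` K) = A.line" unfolding 1(1) using A.line_span by simp
    have "is_partition [n]" "sum_list [n] = n" using n by (simp_all add: is_partition_def)
    moreover have "n \<ge> 1" using n by simp
    ultimately show ?thesis
      unfolding s
      using A.line_Sn_submodule A.line_irreducible specht_module_row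
        line_isomorphic[OF A.invariant_vector_axioms invariant_vector_poly_alg]
      by metis
  next
    case 2
    interpret A: permuted_family n V perm_coset "\<lambda>j. cls (Var j ^ d)" "\<lambda>j. coef j d"
      by (rule permuted_family_quot[OF 2(2,3)])
    have s: "span_V (basis_vec ` K) = A.std" unfolding 2(1) by (rule span_std_block[OF 2(2,3)])
    have "is_partition [n - 1, 1]" "sum_list [n - 1, 1] = n" using n by (auto simp: is_partition_def)
    then show ?thesis
      unfolding s
      using A.std_Sn_submodule A.std_irreducible specht_module_hook[OF n]
        std_isomorphic[OF A.permuted_family_axioms permuted_family_poly_alg[OF n]]
      by metis
  qed
qed

text \<open>The partition is the image of \<open>blocks\<close> under \<open>basis_vec\<close>,
  whose injectivity, a consequence of duality, keeps the parts disjoint. Each part is assigned its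
  own span.\<close>

lemma quotient_higher_specht_basis:
  "higher_specht_basis n V perm_coset (basis_vec ` basis_index n k)"
proof -
  interpret D: dual_basis V "basis_index n k" basis_vec dual_coef by (rule dual_basis)
  have sub: "K \<subseteq> basis_index n k" if "K \<in> blocks" for K
    using that partition_onD1[OF partition_blocks] by blast
  have "{} \<notin> (`) basis_vec ` blocks" using partition_onD3[OF partition_blocks] by auto
  then have part: "partition_on (basis_vec ` basis_index n k) ((`) basis_vec ` blocks)"
    using partition_on_inj_image[OF partition_blocks D.inj] by simp
  show ?thesis
    unfolding higher_specht_basis_def
    using quot_Sn_module D.is_basis part block_components D.basis_span[OF sub]
      direct_sum_span[OF dual_basis partition_blocks]
    by (intro conjI exI[of _ "(`) basis_vec ` blocks"] exI[of _ span_V]) auto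
qed

end

theorem theorem1p10:
  fixes n k :: nat
  assumes "n \<ge> 2" and "k \<ge> 1"
  shows "descends_to_higher_specht_basis n (griffin_ideal n k [n - 1]) (B_set n k)"
proof -
  interpret griffin_quotient n k by (rule griffin_quotient.intro) (use assms in auto)
  interpret D: dual_basis V "basis_index n k" basis_vec dual_coef by (rule dual_basis)
  \<comment> \<open>\<open>basis_vec\<close> is the class map composed with
    \<open>basis_poly\<close>, so its injectivity on the index set makes the class map injective on
    the polynomials themselves.\<close>
  have "inj_on cls (basis_poly n ` basis_index n k)"
    using D.inj unfolding basis_vec_def by (auto simp: inj_on_def)
  moreover have "basis_poly n ` basis_index n k \<subseteq> carrier (poly_alg n)"
    using basis_poly_closed by auto
  moreover have "higher_specht_basis n V perm_coset (cls ` basis_poly n ` basis_index n k)"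
    using quotient_higher_specht_basis by (simp add: image_image basis_vec_def)
  ultimately show ?thesis
    unfolding descends_to_higher_specht_basis_def griffin_ideal_eq[OF assms] B_set_eq[OF assms(1)] by blast
qed

end
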